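(* Let $A\in\mathbb{Z}^{r\times n}$, $\mathbf{b}\in\mathbb{Z}^r$, $M=\begin{pmatrix}\mathrm{id}_n&\mathbf{0}\\ A&-\mathbf{b}\end{pmatrix}$, let $M_k\langle I;J\rangle$ be a (well-defined) matrix obtained from $M$ by $k$ successive pivot operations with row index set $I\subseteq[r]$ and column index set $J\subseteq[n]$, and let $i\in[r]\setminus I$. Let $\mathfrak{c}^+_i,\mathfrak{c}^-_i$ be computed for $[M_k\langle I;J\rangle]$ as in the context. If $\mathfrak{c}^+_i<\infty$, then $$\mathop{\mathrm{CT}}_{\lambda_i}[M_k\langle I;J\rangle]=\sum_{j:\ \gamma_j\text{ is contributing}}\mathrm{sgn}(p_{k+1})\,\mathcal{Z}_{y_j}\big[M_k\langle I;J\rangle\leftarrow(i,j)\big].$$ If $\mathfrak{c}^-_i<\infty$, then $$\mathop{\mathrm{CT}}_{\lambda_i}[M_k\langle I;J\rangle]=-\sum_{j:\ \gamma_j\text{ is dually contributing}}\mathrm{sgn}(p_{k+1})\,\mathcal{Z}_{y_j}\big[M_k\langle I;J\rangle\leftarrow(i,j)\big].$$ Here $p_{k+1}$ (depending on $j$) is the $(n+i,j)$ entry of $M_k\langle I;J\rangle$.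
   Context: Variables: $\mathbf{y}=(y_1,\dots,y_n)$, $\Lambda=(\lambda_1,\dots,\lambda_r)$. "Fractional" means that rational exponents are allowed. All rational functions are expanded in the field of iterated Laurent series $G=\mathbb{C}((\lambda_r^{1/N}))\cdots((\lambda_1^{1/N}))((y_n^{1/N}))\cdots((y_1^{1/N}))$, where $N$ is a sufficiently divisible positive integer. A monomial $x=\zeta(\mathbf{y},\Lambda)^\alpha$ ($\zeta\in\mathbb{C}^*$, $\alpha\in\mathbb{Q}^{n+r}$ nonzero) is small if the first nonzero entry of $\alpha$ is positive, large otherwise; in $G$, $\frac1{1-x}=\sum_{t\ge0}x^t$ if $x$ is small and $\frac1{1-x}=-\sum_{t\ge0}x^{-t-1}$ if $x$ is large. $\mathrm{CT}_{\lambda_i}$ extracts the part of exponent $0$ in $\lambda_i$ of the expansion in $G$. Matrix forms. For an $(n+r)\times(n+1)$ matrix $O$ with nonzero $(n+i,j)$ entry ($i\in[r]$, $j\in[n]$), $O\leftarrow(i,j)$ is obtained from $O$ by adding $-O_{n+i,s}/O_{n+i,j}$ times column $j$ to column $s$ for all $s\ne j$; row $n+i$ and column $j$ are ignored afterwards. For $I=\{i_1,\dots,i_k\}$, $J=\{j_1,\dots,j_k\}$, $M_k\langle I;J\rangle=M\leftarrow(i_1,j_1)\leftarrow\cdots\leftarrow(i_k,j_k)$ (all pivots nonzero), with rows $n+I$ and columns $J$ ignored. With columns $\gamma_1,\dots,\gamma_{n+1}$ (entries in ignored rows omitted), $[M_k\langle I;J\rangle]=(\mathbf{y},\Lambda)^{\gamma_{n+1}}\big/\prod_{j\in[n]\setminus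 J}\big(1-(\mathbf{y},\Lambda)^{\gamma_j}\big)$. $\mathcal{Z}_{y_j}$ keeps exactly the terms of a fractional series in which the exponent of $y_j$ is an integer. Contributing columns. A nonzero vector is small if its first nonzero entry is positive and large otherwise. For $j\in[n]\setminus J$, let $b_j$ be the entry of $\gamma_j$ in row $n+i$, and let $b_0$ be the entry of $\gamma_{n+1}$ in row $n+i$. $\gamma_j$ is contributing (with respect to $\lambda_i$) if $b_j\ne0$ and $b_j\gamma_j$ is small; it is dually contributing if $b_j\neq0$ and $b_j\gamma_j$ is large. Set $\deg=b_0-\sum_{j\notin J,\,b_j>0}b_j$ (the degree of $[M_k\langle I;J\rangle]$ in $\lambda_i$) and $\mathrm{ord}=-b_0+\sum_{j\notin J,\,b_j<0}b_j$ (its pole order at $\lambda_i=0$). $\mathfrak{c}^+_i$ is the number of contributing columns if $\deg<0$, and $\infty$ if $\deg\ge0$; $\mathfrak{c}^-_i$ is the number of dually contributing columns if $\mathrm{ord}<0$, and $\infty$ if $\mathrm{ord}\ge0$. *)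

theory Defs
  imports "HOL-Analysis.Analysis" "HOL-Library.Extended_Nat"
begin

section \<open>Fractional iterated Laurent series\<close>

text \<open>
  Exponent vectors are indexed by a finite linearly ordered type of variables; the smallest variable
  is the outermost one of the iterated Laurent series field, so it dominates the order.
\<close>

definition small :: "rat ^ 'v::{finite,linorder} \<Rightarrow> bool" where
  "small \<alpha> \<longleftrightarrow> (\<exists>v. \<alpha> $ v > 0 \<and> (\<forall>u<v. \<alpha> $ u = 0))"

definition large :: "rat ^ 'v::{finite,linorder} \<Rightarrow> bool" where
  "large \<alpha> \<longleftrightarrow> \<alpha> \<noteq> 0 \<and> \<not> small \<alpha>"

text \<open>
  The supports of the elements of the union over all \<open>N\<close> of the fields
  \<open>\<complex>((v\<^sub>m\<^sup>1\<^sup>/\<^sup>N))\<dots>((v\<^sub>1\<^sup>1\<^sup>/\<^sup>N))\<close>, where \<open>v\<^sub>1 < \<dots> < v\<^sub>m\<close> are the variables: the exponents have a common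
  denominator, and among the terms with prescribed exponents of the variables before \<open>v\<close> the
  exponents of \<open>v\<close> are bounded below.
\<close>

definition laurent_support :: "(rat ^ 'v::{finite,linorder}) set \<Rightarrow> bool" where
  "laurent_support S \<longleftrightarrow>
     (\<exists>N>0. \<forall>\<alpha>\<in>S. \<forall>v. of_nat N * \<alpha> $ v \<in> \<int>) \<and>
     (\<forall>v \<beta>. bdd_below {\<alpha> $ v | \<alpha>. \<alpha> \<in> S \<and> (\<forall>u<v. \<alpha> $ u = \<beta> $ u)})"

subsection \<open>Well-ordered subsets of ordered groups\<close>

definition wo_set :: "('a \<Rightarrow> 'a \<Rightarrow> bool) \<Rightarrow> 'a set \<Rightarrow> bool" where
  "wo_set le S \<longleftrightarrow> (\<forall>T. T \<subseteq> S \<longrightarrow> T \<noteq> {} \<longrightarrow> (\<exists>m\<in>T. \<forall>x\<in>T. le m x))"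

lemma wo_set_subset: "wo_set le S \<Longrightarrow> T \<subseteq> S \<Longrightarrow> wo_set le T"
  unfolding wo_set_def by (meson subset_trans)

inductive_set sums_of :: "('a \<Rightarrow> 'a \<Rightarrow> 'a) \<Rightarrow> 'a \<Rightarrow> 'a set \<Rightarrow> 'a set" for pl z S where
  zero: "z \<in> sums_of pl z S"
| add: "s \<in> S \<Longrightarrow> x \<in> sums_of pl z S \<Longrightarrow> pl s x \<in> sums_of pl z S"

context linorder
begin

lemma wo_set_iff_no_descent:
  "wo_set (\<le>) S \<longleftrightarrow> (\<nexists>x::nat \<Rightarrow> 'a. \<forall>k. x k \<in> S \<and> x (Suc k) < x k)"
proof
  assume wo: "wo_set (\<le>) S"
  show "\<nexists>x::nat \<Rightarrow> 'a. \<forall>k. x k \<in> S \<and> x (Suc k) < x k"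
  proof
    assume "\<exists>x::nat \<Rightarrow> 'a. \<forall>k. x k \<in> S \<and> x (Suc k) < x k"
    then obtain x :: "nat \<Rightarrow> 'a" where x: "\<And>k. x k \<in> S" "\<And>k. x (Suc k) < x k" by blast
    have "\<exists>m\<in>range x. \<forall>y\<in>range x. m \<le> y"
      using wo x(1) unfolding wo_set_def by (meson image_subsetI UNIV_not_empty image_is_empty)
    then obtain k where "\<And>l. x k \<le> x l" by auto
    then show False using x(2)[of k] by (meson leD)
  qed
next
  assume nd: "\<nexists>x::nat \<Rightarrow> 'a. \<forall>k. x k \<in> S \<and> x (Suc k) < x k"
  show "wo_set (\<le>) S"
    unfolding wo_set_def
  proof (intro allI impI, rule ccontr)
    fix T assume T: "T \<subseteq> S" "T \<noteq> {}" "\<not> (\<exists>m\<in>T. \<forall>x\<in>T. m \<le> x)"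
    have "\<exists>f. \<forall>n::nat. f n \<in> T \<and> f (Suc n) < f n"
    proof (rule dependent_nat_choice)
      show "\<exists>x. x \<in> T" using T by blast
      show "\<exists>y. y \<in> T \<and> y < x" if "x \<in> T" for x using T(3) that by (meson not_le)
    qed
    then show False using nd T(1) by blast
  qed
qed

lemma wo_set_mono_subseq:
  assumes wo: "wo_set (\<le>) S" and x: "\<And>k::nat. x k \<in> S"
  obtains r where "\<And>j::nat. (r j :: nat) < r (Suc j)" "\<And>j. x (r j) \<le> x (r (Suc j))"
proof -
  have min: "\<exists>i\<ge>n. \<forall>m\<ge>n. x i \<le> x m" for n
  proof -
    have "x ` {n..} \<subseteq> S" "x ` {n..} \<noteq> {}" using x by auto
    then have "\<exists>m\<in>x ` {n..}. \<forall>y\<in>x ` {n..}. m \<le> y" using wo unfolding wo_set_def by blast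
    then show ?thesis by auto
  qed
  have "\<exists>r. \<forall>j::nat. (\<forall>m\<ge>r j. x (r j) \<le> x m) \<and> r j < r (Suc j)"
  proof (rule dependent_nat_choice)
    show "\<exists>i. \<forall>m\<ge>i. x i \<le> x m" using min[of 0] by auto
    show "\<exists>l. (\<forall>m\<ge>l. x l \<le> x m) \<and> i < l" for i
      using min[of "Suc i"] by (meson Suc_le_lessD le_trans)
  qed
  then obtain r where r: "\<And>j m. m \<ge> r j \<Longrightarrow> x (r j) \<le> x m" "\<And>j. r j < r (Suc j)" by blast
  show thesis
  proof
    show "r j < r (Suc j)" for j by (rule r(2))
    show "x (r j) \<le> x (r (Suc j))" for j using r by (meson Orderings.less_imp_le)
  qed
qed

end

context linordered_ab_group_add
begin

lemma wo_set_plus: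
  assumes S: "wo_set (\<le>) S" and T: "wo_set (\<le>) T"
  shows "wo_set (\<le>) {a + b | a b. a \<in> S \<and> b \<in> T}"
  unfolding wo_set_iff_no_descent
proof
  assume "\<exists>x::nat \<Rightarrow> 'a. \<forall>k. x k \<in> {a + b | a b. a \<in> S \<and> b \<in> T} \<and> x (Suc k) < x k"
  then obtain x :: "nat \<Rightarrow> 'a" where x: "\<And>k. \<exists>a b. x k = a + b \<and> a \<in> S \<and> b \<in> T"
    and d: "\<And>k. x (Suc k) < x k" by blast
  obtain a b where ab: "\<And>k. x k = a k + b k" "\<And>k. a k \<in> S" "\<And>k. b k \<in> T"
    using x by metis
  obtain r where r: "\<And>j::nat. (r j :: nat) < r (Suc j)" "\<And>j. a (r j) \<le> a (r (Suc j))"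
    using wo_set_mono_subseq[OF S, of a] ab(2) by blast
  have anti: "x l < x k" if "k < l" for k l
    using that
  proof (induction l)
    case (Suc l)
    show ?case
    proof (cases "k = l")
      case True
      then show ?thesis using d[of l] by blast
    next
      case False
      then have "k < l" using Suc.prems less_SucE by blast
      then show ?thesis using less_trans[OF d[of l]] Suc.IH by blast
    qed
  qed simp
  have "b (r (Suc j)) < b (r j)" for j
  proof -
    have "x (r (Suc j)) < x (r j)"
      by (rule anti[OF r(1)])
    then have "a (r (Suc j)) + b (r (Suc j)) < a (r j) + b (r j)" by (simp add: ab(1))
    also have "\<dots> \<le> a (r (Suc j)) + b (r j)" using r(2) by (rule add_right_mono)
    finally show ?thesis by simp
  qed
  then have "\<exists>x. \<forall>k::nat. x k \<in> T \<and> x (Suc k) < x k"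
    using ab(3) by (intro exI[of _ "\<lambda>j. b (r j)"]) auto
  then show False using T unfolding wo_set_iff_no_descent by blast
qed

lemma wo_set_finite_decomp:
  assumes S: "wo_set (\<le>) S" and T: "wo_set (\<le>) T"
  shows "finite {a \<in> S. c - a \<in> T}"
proof (rule ccontr)
  assume "infinite {a \<in> S. c - a \<in> T}"
  then obtain a :: "nat \<Rightarrow> 'a" where a: "inj a" "range a \<subseteq> {a \<in> S. c - a \<in> T}"
    using infinite_countable_subset by blast
  have a': "a k \<in> S" "c - a k \<in> T" for k using a(2) by auto
  obtain r where r: "\<And>j::nat. (r j :: nat) < r (Suc j)" "\<And>j. a (r j) \<le> a (r (Suc j))"
    using wo_set_mono_subseq[OF S, of a] a' by blast
  have "a (r j) < a (r (Suc j))" for j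
  proof -
    have "r j \<noteq> r (Suc j)" using r(1)[of j] by simp
    then have "a (r j) \<noteq> a (r (Suc j))" using a(1) by (simp add: inj_eq)
    then show ?thesis using r(2)[of j] by (simp add: less_le)
  qed
  then have "c - a (r (Suc j)) < c - a (r j)" for j
    by (simp add: diff_strict_left_mono)
  then have "\<exists>x. \<forall>k::nat. x k \<in> T \<and> x (Suc k) < x k"
    using a'(2) by (intro exI[of _ "\<lambda>j. c - a (r j)"]) auto
  then show False using T unfolding wo_set_iff_no_descent by blast
qed


lemma sums_of_nonneg:
  assumes "\<And>s. s \<in> S \<Longrightarrow> 0 < s" "x \<in> sums_of (+) 0 S" shows "0 \<le> x"
  using assms(2)
proof induction
  case zero show ?case by (rule order_refl)
next
  case (add s x)
  then show ?case using assms(1)[of s] by (intro add_nonneg_nonneg) (auto intro: less_imp_le)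
qed

lemma wo_set_sums_of:
  assumes S: "wo_set (\<le>) S" and pos: "\<And>s. s \<in> S \<Longrightarrow> 0 < s"
  shows "wo_set (\<le>) (sums_of (+) 0 S)"
proof -
  define W where "W = sums_of (+) 0 S"
  define P where "P = rec_nat {0} (\<lambda>_ X. {s + x | s x. s \<in> S \<and> x \<in> X})"
  have P0: "P 0 = {0}" and PS: "P (Suc n) = {s + x | s x. s \<in> S \<and> x \<in> P n}" for n
    by (simp_all add: P_def)
  have PW: "x \<in> P n \<Longrightarrow> x \<in> W" for x n
    by (induction n arbitrary: x) (auto simp: P0 PS W_def intro: sums_of.intros)
  have WP: "\<exists>n. x \<in> P n" if "x \<in> W" for x
    using that unfolding W_def
  proof induction
    case zero show ?case using P0 by blast
  next
    case (add s x) then show ?case using PS by blast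
  qed
  define len where "len x = (LEAST n. x \<in> P n)" for x
  have len: "x \<in> P (len x)" if "x \<in> W" for x unfolding len_def using WP[OF that] by (rule LeastI_ex)
  have len_le: "len x \<le> n" if "x \<in> P n" for x n unfolding len_def using that by (rule Least_le)
  define bad where "bad x \<longleftrightarrow> (\<exists>f. f (0::nat) = x \<and> (\<forall>k. f k \<in> W \<and> f (Suc k) < f k))" for x
  have badW: "x \<in> W" if "bad x" for x using that unfolding bad_def by blast
  have bad_step: "\<exists>y. bad y \<and> y < x" if b: "bad x" for x
  proof -
    obtain f where f: "f (0::nat) = x" "\<forall>k. f k \<in> W \<and> f (Suc k) < f k" using b unfolding bad_def by blast
    have "bad (f (Suc 0))" unfolding bad_def using f(2) by (intro exI[of _ "\<lambda>k. f (Suc k)"]) auto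
    then show ?thesis using f by blast
  qed
  have "False" if ex: "\<exists>x. bad x"
  proof -
    have ml: "\<exists>x. Q x \<and> (\<forall>y. Q y \<longrightarrow> len x \<le> len y)" if QQ: "\<exists>x. Q x" for Q
    proof -
      obtain x0 where "Q x0" using QQ by blast
      then show ?thesis using ex_has_least_nat[of Q x0 len] by blast
    qed
    have "\<exists>f. \<forall>k::nat. (bad (f k) \<and> (k = 0 \<longrightarrow> (\<forall>y. bad y \<longrightarrow> len (f k) \<le> len y)))
       \<and> (f (Suc k) < f k \<and> (\<forall>y. bad y \<and> y < f k \<longrightarrow> len (f (Suc k)) \<le> len y))"
    proof (rule dependent_nat_choice)
      show "\<exists>x. bad x \<and> ((0::nat) = 0 \<longrightarrow> (\<forall>y. bad y \<longrightarrow> len x \<le> len y))"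
        using ml[of bad] ex by blast
      fix x and n :: nat assume "bad x \<and> (n = 0 \<longrightarrow> (\<forall>y. bad y \<longrightarrow> len x \<le> len y))"
      then have "\<exists>y. bad y \<and> y < x" using bad_step by blast
      then show "\<exists>y. (bad y \<and> (Suc n = 0 \<longrightarrow> (\<forall>z. bad z \<longrightarrow> len y \<le> len z)))
          \<and> (y < x \<and> (\<forall>z. bad z \<and> z < x \<longrightarrow> len y \<le> len z))"
        using ml[of "\<lambda>y. bad y \<and> y < x"] by auto
    qed
    then obtain f where F: "\<forall>k::nat. (bad (f k) \<and> (k = 0 \<longrightarrow> (\<forall>y. bad y \<longrightarrow> len (f k) \<le> len y)))
       \<and> (f (Suc k) < f k \<and> (\<forall>y. bad y \<and> y < f k \<longrightarrow> len (f (Suc k)) \<le> len y))"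
      by (rule exE)
    have f: "bad (f k)" "f (Suc k) < f k" for k using F[rule_format, of k] by simp_all
    have f0: "len (f 0) \<le> len y" if "bad y" for y using F[rule_format, of 0] that by simp
    have fS: "len (f (Suc k)) \<le> len y" if "bad y" "y < f k" for k y
      using F[rule_format, of k] that by simp
    have fm: "f l < f k" if "k < l" for k l
      using that
    proof (induction l)
      case (Suc l)
      show ?case
      proof (cases "k = l")
        case True
        then show ?thesis using f(2)[of l] by blast
      next
        case False
        then have "k < l" using Suc.prems less_SucE by blast
        then show ?thesis using less_trans[OF f(2)[of l]] Suc.IH by blast
      qed
    qed simp
    have fpos: "f k \<noteq> 0" for k
    proof -
      have "0 \<le> f (Suc k)" using sums_of_nonneg[OF pos] badW[OF f(1)] unfolding W_def by blast
      then show ?thesis using f(2)[of k] by auto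
    qed
    have "\<exists>s x. f k = s + x \<and> s \<in> S \<and> x \<in> W \<and> len x < len (f k)" for k
    proof -
      have *: "f k \<in> P (len (f k))" using len badW f(1) by blast
      then obtain n where n: "len (f k) = Suc n" using fpos[of k] P0 by (cases "len (f k)") auto
      then obtain s x where sx: "f k = s + x" "s \<in> S" "x \<in> P n" using * PS by auto
      then show ?thesis using len_le[OF sx(3)] PW[OF sx(3)] n by (metis less_Suc_eq_le)
    qed
    then obtain s x where sx: "\<And>k. f k = s k + x k" "\<And>k. s k \<in> S" "\<And>k. x k \<in> W" "\<And>k. len (x k) < len (f k)"
      by metis
    obtain r where r: "\<And>j::nat. (r j :: nat) < r (Suc j)" "\<And>j. s (r j) \<le> s (r (Suc j))"
      using wo_set_mono_subseq[OF S, of s] sx(2) by blast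
    have "x (r (Suc j)) < x (r j)" for j
    proof -
      have "f (r (Suc j)) < f (r j)" by (rule fm[OF r(1)])
      then have "s (r (Suc j)) + x (r (Suc j)) < s (r j) + x (r j)" by (simp add: sx(1))
      also have "\<dots> \<le> s (r (Suc j)) + x (r j)" using r(2) by (rule add_right_mono)
      finally show ?thesis by simp
    qed
    then have b: "bad (x (r 0))" unfolding bad_def using sx(3) by (intro exI[of _ "\<lambda>j. x (r j)"]) auto
    have le: "x (r 0) < f (r 0)" using sx(1)[of "r 0"] pos[OF sx(2)[of "r 0"]] by simp
    show False
    proof (cases "r 0")
      case 0
      then show False using f0[OF b] sx(4)[of "r 0"] by simp
    next
      case (Suc k)
      have "x (r 0) < f k" using less_trans[OF le, of "f k"] f(2)[of k] Suc by simp
      then show False using fS[OF b] sx(4)[of "r 0"] Suc by fastforce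
    qed
  qed
  then have "\<nexists>x. bad x" by blast
  then show ?thesis unfolding wo_set_iff_no_descent W_def[symmetric] bad_def by blast
qed

end

subsection \<open>The lexicographic order on exponents\<close>

definition lex_less :: "rat ^ 'v::{finite,linorder} \<Rightarrow> rat ^ 'v::{finite,linorder} \<Rightarrow> bool" where
  "lex_less \<alpha> \<beta> \<longleftrightarrow> small (\<beta> - \<alpha>)"

definition lex_le :: "rat ^ 'v::{finite,linorder} \<Rightarrow> rat ^ 'v::{finite,linorder} \<Rightarrow> bool" where
  "lex_le \<alpha> \<beta> \<longleftrightarrow> \<alpha> = \<beta> \<or> small (\<beta> - \<alpha>)"

lemma small_add: "small \<alpha> \<Longrightarrow> small \<beta> \<Longrightarrow> small (\<alpha> + \<beta>)"
proof -
  assume "small \<alpha>" "small \<beta>"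
  then obtain v w where v: "\<alpha> $ v > 0" "\<forall>u<v. \<alpha> $ u = 0" and w: "\<beta> $ w > 0" "\<forall>u<w. \<beta> $ u = 0"
    unfolding small_def by blast
  have "(\<alpha> + \<beta>) $ min v w > 0 \<and> (\<forall>u<min v w. (\<alpha> + \<beta>) $ u = 0)"
    using v w by (cases v w rule: linorder_cases) (auto simp: min_def)
  then show ?thesis unfolding small_def by blast
qed

lemma not_small_zero [simp]: "\<not> small 0"
  by (auto simp: small_def)

lemma small_uminus: "small \<alpha> \<Longrightarrow> \<not> small (- \<alpha>)"
  using small_add[of \<alpha> "- \<alpha>"] by auto

lemma small_cases: "\<alpha> \<noteq> 0 \<Longrightarrow> small \<alpha> \<or> small (- \<alpha>)"
proof -
  assume "\<alpha> \<noteq> 0"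
  then have ne: "{v. \<alpha> $ v \<noteq> 0} \<noteq> {}" by (auto simp: vec_eq_iff)
  define v where "v = Min {v. \<alpha> $ v \<noteq> 0}"
  have "\<alpha> $ v \<noteq> 0" using Min_in[OF _ ne] by (simp add: v_def)
  moreover have "\<alpha> $ u = 0" if "u < v" for u
    using that Min_le[of "{v. \<alpha> $ v \<noteq> 0}" u] by (fastforce simp: v_def)
  ultimately have "\<alpha> $ v > 0 \<and> (\<forall>u<v. \<alpha> $ u = 0) \<or> (- \<alpha>) $ v > 0 \<and> (\<forall>u<v. (- \<alpha>) $ u = 0)"
    by auto
  then show ?thesis unfolding small_def by blast
qed

interpretation lex: linordered_ab_group_add "(+)" "0 :: rat ^ 'v::{finite,linorder}" "(-)" uminus lex_le lex_less
proof
  fix a b c :: "rat ^ 'v::{finite,linorder}"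
  show "lex_less a b \<longleftrightarrow> lex_le a b \<and> \<not> lex_le b a"
    using small_uminus[of "b - a"] by (auto simp: lex_less_def lex_le_def)
  show "lex_le a a" by (simp add: lex_le_def)
  show "lex_le a c" if "lex_le a b" "lex_le b c"
    using that small_add[of "b - a" "c - b"] by (auto simp: lex_le_def)
  show "a = b" if "lex_le a b" "lex_le b a"
    using that small_uminus[of "b - a"] by (auto simp: lex_le_def)
  show "lex_le a b \<or> lex_le b a"
    using small_cases[of "b - a"] by (auto simp: lex_le_def)
  show "lex_le (c + a) (c + b)" if "lex_le a b"
    using that by (auto simp: lex_le_def)
qed

definition common_denom :: "(rat ^ 'v::finite) set \<Rightarrow> bool" where
  "common_denom S \<longleftrightarrow> (\<exists>N>0. \<forall>\<alpha>\<in>S. \<forall>v. of_nat N * \<alpha> $ v \<in> \<int>)"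

lemma bounded_descent_eventually_const:
  fixes x :: "nat \<Rightarrow> rat"
  assumes N: "N > 0" "\<And>k. of_nat N * x k \<in> \<int>"
    and bb: "\<And>k. c \<le> x k" and dec: "\<And>k. x (Suc k) \<le> x k"
  shows "\<exists>K. \<forall>k\<ge>K. x k = x K"
proof -
  define z where "z k = nat (\<lfloor>of_nat N * x k\<rfloor> - \<lfloor>of_nat N * c\<rfloor>)" for k
  have ge: "\<lfloor>of_nat N * c\<rfloor> \<le> \<lfloor>of_nat N * x k\<rfloor>" for k
    using bb[of k] by (intro floor_mono mult_left_mono) auto
  have dx: "x l \<le> x k" if "k \<le> l" for k l
    using that by (rule lift_Suc_antimono_le[of x, OF dec])
  obtain K where K: "\<And>k. z K \<le> z k"
    using ex_has_least_nat[of "\<lambda>_. True" _ z] by auto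
  have "x k = x K" if "k \<ge> K" for k
  proof -
    have 1: "x k \<le> x K" using dx that by blast
    have "\<lfloor>of_nat N * x K\<rfloor> \<le> \<lfloor>of_nat N * x k\<rfloor>" using K[of k] ge[of k] ge[of K] by (simp add: z_def)
    then have "of_int \<lfloor>of_nat N * x K\<rfloor> \<le> (of_int \<lfloor>of_nat N * x k\<rfloor> :: rat)" by simp
    then have "of_nat N * x K \<le> of_nat N * x k"
      using N(2) by (metis Ints_cases floor_of_int)
    then show ?thesis using N(1) 1 by simp
  qed
  then show ?thesis by blast
qed

lemma laurent_support_iff:
  "laurent_support S \<longleftrightarrow> common_denom S \<and> wo_set lex_le S"
proof (intro iffI conjI)
  assume L: "laurent_support S"
  then show "common_denom S" unfolding laurent_support_def common_denom_def by blast
  obtain N where N: "N > 0" "\<And>\<alpha> v. \<alpha> \<in> S \<Longrightarrow> of_nat N * \<alpha> $ v \<in> \<int>"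
    using L unfolding laurent_support_def by blast
  have bb: "bdd_below {\<alpha> $ v | \<alpha>. \<alpha> \<in> S \<and> (\<forall>u<v. \<alpha> $ u = \<beta> $ u)}" for v \<beta>
    using L[unfolded laurent_support_def, THEN conjunct2] by (elim allE)
  show "wo_set lex_le S"
    unfolding lex.wo_set_iff_no_descent
  proof
    assume "\<exists>x. \<forall>k::nat. x k \<in> S \<and> lex_less (x (Suc k)) (x k)"
    then obtain x where x: "\<And>k::nat. x k \<in> S" "\<And>k. small (x k - x (Suc k))"
      unfolding lex_less_def by blast
    have ev: "\<exists>K. \<forall>k\<ge>K. x k $ v = x K $ v" for v
    proof (induction v rule: measure_induct_rule[where f = "\<lambda>v. card {..<v}"])
      case (less v)
      have "\<exists>K. \<forall>k\<ge>K. x k $ u = x K $ u" if "u < v" for u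
      proof (rule less)
        show "card {..<u} < card {..<v}" using that by (intro psubset_card_mono) auto
      qed
      then obtain K where K: "\<And>u k. u < v \<Longrightarrow> k \<ge> K u \<Longrightarrow> x k $ u = x (K u) $ u" by metis
      define L where "L = Max (insert 0 (K ` {..<v}))"
      have LK: "K u \<le> L" if "u < v" for u using that unfolding L_def by (intro Max_ge) auto
      have pre: "x k $ u = x L $ u" if "u < v" "k \<ge> L" for u k
        using K[OF that(1), of k] K[OF that(1), of L] LK[OF that(1)] that(2) by simp
      obtain c where c: "\<And>\<alpha>. \<alpha> \<in> S \<Longrightarrow> (\<forall>u<v. \<alpha> $ u = x L $ u) \<Longrightarrow> c \<le> \<alpha> $ v"
        using bb[of v "x L"] unfolding bdd_below_def by blast
      have "\<exists>K. \<forall>k\<ge>K. x (k + L) $ v = x (K + L) $ v"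
      proof (rule bounded_descent_eventually_const[OF N(1)])
        show "of_nat N * x (k + L) $ v \<in> \<int>" for k using N(2) x(1) .
        show "c \<le> x (k + L) $ v" for k using c[OF x(1)[of "k + L"]] pre[of _ "k + L"] by simp
        show "x (Suc k + L) $ v \<le> x (k + L) $ v" for k
        proof -
          obtain w where w: "(x (k + L) - x (Suc (k + L))) $ w > 0"
            "\<And>u. u < w \<Longrightarrow> (x (k + L) - x (Suc (k + L))) $ u = 0"
            using x(2)[of "k + L"] unfolding small_def by blast
          have "v \<le> w"
          proof (rule ccontr)
            assume "\<not> v \<le> w"
            then show False using w(1) pre[of w "k + L"] pre[of w "Suc (k + L)"] by simp
          qed
          then show ?thesis using w by (cases "v = w") auto
        qed
      qed
      then obtain K' where K': "\<And>k. k \<ge> K' \<Longrightarrow> x (k + L) $ v = x (K' + L) $ v" by blast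
      have "x k $ v = x (K' + L) $ v" if "k \<ge> K' + L" for k
        using that K'[of "k - L"] by simp
      then show ?case by blast
    qed
    then obtain K where K: "\<And>v k. k \<ge> K v \<Longrightarrow> x k $ v = x (K v) $ v" by metis
    define L where "L = Max (range K)"
    have "K v \<le> L" for v unfolding L_def by (intro Max_ge) auto
    then have "x (Suc L) = x L" using K by (metis vec_eq_iff le_SucI)
    then show False using x(2)[of L] by simp
  qed
next
  assume R: "common_denom S \<and> wo_set lex_le S"
  show "laurent_support S"
    unfolding laurent_support_def
  proof (intro conjI allI)
    show "\<exists>N>0. \<forall>\<alpha>\<in>S. \<forall>v. of_nat N * \<alpha> $ v \<in> \<int>" using R unfolding common_denom_def by blast
    fix v \<beta>
    define T where "T = {\<alpha> \<in> S. \<forall>u<v. \<alpha> $ u = \<beta> $ u}"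
    have "\<exists>c. \<forall>\<alpha>\<in>T. c \<le> \<alpha> $ v"
    proof (cases "T = {}")
      case False
      then obtain m where m: "m \<in> T" "\<And>\<alpha>. \<alpha> \<in> T \<Longrightarrow> lex_le m \<alpha>"
        using R unfolding wo_set_def T_def by (metis (no_types, lifting) mem_Collect_eq subsetI)
      have "m $ v \<le> \<alpha> $ v" if a: "\<alpha> \<in> T" for \<alpha>
      proof (cases "\<alpha> = m")
        case False
        then obtain w where w: "(\<alpha> - m) $ w > 0" "\<And>u. u < w \<Longrightarrow> (\<alpha> - m) $ u = 0"
          using m(2)[OF a] unfolding lex_le_def small_def by blast
        have "v \<le> w" using w(1) m(1) a unfolding T_def by (metis (mono_tags, lifting) diff_self less_irrefl mem_Collect_eq not_le_imp_less vector_minus_component)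
        then show ?thesis using w by (cases "v = w") auto
      qed auto
      then show ?thesis by blast
    qed auto
    then show "bdd_below {\<alpha> $ v | \<alpha>. \<alpha> \<in> S \<and> (\<forall>u<v. \<alpha> $ u = \<beta> $ u)}"
      unfolding bdd_below_def T_def by blast
  qed
qed

lemma common_denom_subset: "common_denom S \<Longrightarrow> T \<subseteq> S \<Longrightarrow> common_denom T"
  unfolding common_denom_def by blast

lemma common_denom_Un:
  assumes "common_denom S" "common_denom T" shows "common_denom (S \<union> T)"
proof -
  obtain N M where N: "N > 0" "\<And>\<alpha> v. \<alpha> \<in> S \<Longrightarrow> of_nat N * \<alpha> $ v \<in> \<int>"
    and M: "M > 0" "\<And>\<alpha> v. \<alpha> \<in> T \<Longrightarrow> of_nat M * \<alpha> $ v \<in> \<int>"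
    using assms unfolding common_denom_def by metis
  have "of_nat (N * M) * \<alpha> $ v \<in> \<int>" if "\<alpha> \<in> S \<union> T" for \<alpha> v
  proof (cases "\<alpha> \<in> S")
    case True
    then have "of_nat M * (of_nat N * \<alpha> $ v) \<in> \<int>" by (intro Ints_mult Ints_of_nat N(2) True)
    then show ?thesis by (simp add: ac_simps)
  next
    case False
    then have "\<alpha> \<in> T" using that by simp
    then have "of_nat N * (of_nat M * \<alpha> $ v) \<in> \<int>" by (intro Ints_mult Ints_of_nat M(2))
    then show ?thesis by (simp add: ac_simps)
  qed
  then show ?thesis unfolding common_denom_def using N(1) M(1) by (metis nat_0_less_mult_iff)
qed

lemma common_denom_sums_of:
  assumes "common_denom S" shows "common_denom (sums_of (+) 0 S)"
proof -
  obtain N where N: "N > 0" "\<And>\<alpha> v. \<alpha> \<in> S \<Longrightarrow> of_nat N * \<alpha> $ v \<in> \<int>"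
    using assms unfolding common_denom_def by blast
  have "of_nat N * \<alpha> $ v \<in> \<int>" if "\<alpha> \<in> sums_of (+) 0 S" for \<alpha> v
    using that by induction (auto simp: distrib_left intro!: Ints_add N(2))
  then show ?thesis unfolding common_denom_def using N(1) by blast
qed

lemma common_denom_plus:
  assumes "common_denom S" "common_denom T" shows "common_denom {a + b | a b. a \<in> S \<and> b \<in> T}"
proof (rule common_denom_subset[OF common_denom_sums_of[OF common_denom_Un[OF assms]]], safe)
  fix a b assume "a \<in> S" "b \<in> T"
  then have "a + (b + 0) \<in> sums_of (+) 0 (S \<union> T)" by (intro sums_of.intros) auto
  then show "a + b \<in> sums_of (+) 0 (S \<union> T)" by simp
qed

lemma laurent_support_subset: "laurent_support S \<Longrightarrow> T \<subseteq> S \<Longrightarrow> laurent_support T"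
  unfolding laurent_support_iff using common_denom_subset wo_set_subset by blast

lemma laurent_support_Un:
  assumes "laurent_support S" "laurent_support T" shows "laurent_support (S \<union> T)"
proof -
  have "wo_set lex_le (S \<union> T)"
    unfolding wo_set_def
  proof (intro allI impI)
    fix U assume U: "U \<subseteq> S \<union> T" "U \<noteq> {}"
    have S: "U \<inter> S \<noteq> {} \<Longrightarrow> \<exists>m\<in>U \<inter> S. \<forall>x\<in>U \<inter> S. lex_le m x"
      using assms(1) unfolding laurent_support_iff wo_set_def by blast
    have T: "U \<inter> T \<noteq> {} \<Longrightarrow> \<exists>m\<in>U \<inter> T. \<forall>x\<in>U \<inter> T. lex_le m x"
      using assms(2) unfolding laurent_support_iff wo_set_def by blast
    show "\<exists>m\<in>U. \<forall>x\<in>U. lex_le m x"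
    proof (cases "U \<inter> S = {} \<or> U \<inter> T = {}")
      case True then show ?thesis using S T U by blast
    next
      case False
      then obtain m n where "m\<in>U" "\<forall>x\<in>U \<inter> S. lex_le m x" "n\<in>U" "\<forall>x\<in>U \<inter> T. lex_le n x"
        using S T by blast
      then have mn: "m \<in> U" "n \<in> U" "\<And>x. x \<in> U \<Longrightarrow> lex_le m x \<or> lex_le n x" using U(1) by blast+
      show ?thesis
      proof (cases "lex_le m n")
        case True
        then have "\<forall>x\<in>U. lex_le m x" using mn(3) lex.order_trans by blast
        then show ?thesis using mn(1) by blast
      next
        case False
        then have "lex_le n m" using lex.linear by blast
        then have "\<forall>x\<in>U. lex_le n x" using mn(3) lex.order_trans by blast
        then show ?thesis using mn(2) by blast
      qed
    qed
  qed
  then show ?thesis using assms common_denom_Un unfolding laurent_support_iff by blast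
qed

lemma laurent_support_plus:
  "laurent_support S \<Longrightarrow> laurent_support T \<Longrightarrow> laurent_support {a + b | a b. a \<in> S \<and> b \<in> T}"
  unfolding laurent_support_iff using common_denom_plus lex.wo_set_plus by blast

lemma laurent_support_finite_decomp:
  "laurent_support S \<Longrightarrow> laurent_support T \<Longrightarrow> finite {a \<in> S. c - a \<in> T}"
  unfolding laurent_support_iff using lex.wo_set_finite_decomp by blast

lemma laurent_support_sums_of:
  "laurent_support S \<Longrightarrow> (\<And>s. s \<in> S \<Longrightarrow> small s) \<Longrightarrow> laurent_support (sums_of (+) 0 S)"
  unfolding laurent_support_iff using common_denom_sums_of lex.wo_set_sums_of[of S]
  by (auto simp: lex_less_def)

lemma laurent_support_singleton: "laurent_support {\<alpha> :: rat ^ 'v::{finite,linorder}}"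
proof -
  have "\<exists>N>0. of_nat N * (\<alpha> $ v) \<in> \<int>" for v
  proof -
    obtain a b where ab: "\<alpha> $ v = Fract a b" "b > 0" by (meson Rat_cases)
    then have "of_nat (nat b) * (\<alpha> $ v) = of_int a" by (simp add: Fract_of_int_quotient)
    then show ?thesis using ab(2) by (intro exI[of _ "nat b"]) auto
  qed
  then obtain N where N: "\<And>v. N v > 0" "\<And>v. of_nat (N v) * (\<alpha> $ v) \<in> \<int>" by metis
  have "of_nat (prod N UNIV) * \<alpha> $ v \<in> \<int>" for v
  proof -
    have "prod N UNIV = prod N (UNIV - {v}) * N v" by (subst prod.remove[of _ v]) auto
    then have "of_nat (prod N UNIV) * \<alpha> $ v = of_nat (prod N (UNIV - {v})) * (of_nat (N v) * \<alpha> $ v)"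
      by (simp add: mult.assoc del: of_nat_prod)
    then show ?thesis using N(2) by (metis Ints_mult Ints_of_nat)
  qed
  moreover have "prod N UNIV > 0" using N(1) by (simp add: prod_pos)
  ultimately have "common_denom {\<alpha>}" unfolding common_denom_def by blast
  moreover have "wo_set lex_le {\<alpha>}" unfolding wo_set_def by (auto simp: subset_singleton_iff)
  ultimately show ?thesis unfolding laurent_support_iff by blast
qed

lemma laurent_support_empty: "laurent_support {}"
  using laurent_support_subset[OF laurent_support_singleton] by blast


subsection \<open>The field\<close>

typedef (overloaded) 'v::"{finite,linorder}" laurent =
  "{F :: (rat, 'v) vec \<Rightarrow> complex. laurent_support {\<alpha>. F \<alpha> \<noteq> 0}}"
  morphisms lcoeff Abs_laurent
  by (rule exI[of _ "\<lambda>_. 0"]) (simp add: laurent_support_empty)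

setup_lifting type_definition_laurent

lemma laurent_eqI: "(\<And>\<alpha>. lcoeff F \<alpha> = lcoeff G \<alpha>) \<Longrightarrow> F = G"
  by (simp add: lcoeff_inject[symmetric] fun_eq_iff)

lemma laurent_support_lcoeff: "laurent_support {\<alpha>. lcoeff F \<alpha> \<noteq> 0}"
  using lcoeff[of F] by simp

lift_definition monomial :: "complex \<Rightarrow> rat ^ 'v::{finite,linorder} \<Rightarrow> 'v laurent" is
  "\<lambda>c \<alpha> \<beta>. if \<beta> = \<alpha> then c else 0"
  by (rule laurent_support_subset[OF laurent_support_singleton]) auto

lemma finite_times_support:
  "finite {\<alpha>. lcoeff F \<alpha> \<noteq> 0 \<and> lcoeff G (\<gamma> - \<alpha>) \<noteq> 0}"
  using laurent_support_finite_decomp[OF laurent_support_lcoeff laurent_support_lcoeff, of F \<gamma> G] by simp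

instantiation laurent :: ("{finite,linorder}") comm_ring_1
begin

lift_definition zero_laurent :: "'a laurent" is "\<lambda>_. 0"
  by (simp add: laurent_support_empty)

definition one_laurent :: "'a laurent" where "1 = monomial 1 0"

lift_definition plus_laurent :: "'a laurent \<Rightarrow> 'a laurent \<Rightarrow> 'a laurent" is "\<lambda>F G \<alpha>. F \<alpha> + G \<alpha>"
  by (rule laurent_support_subset, erule (1) laurent_support_Un, auto)

lift_definition uminus_laurent :: "'a laurent \<Rightarrow> 'a laurent" is "\<lambda>F \<alpha>. - F \<alpha>"
  by simp

lift_definition minus_laurent :: "'a laurent \<Rightarrow> 'a laurent \<Rightarrow> 'a laurent" is "\<lambda>F G \<alpha>. F \<alpha> - G \<alpha>"
  by (rule laurent_support_subset, erule (1) laurent_support_Un, auto)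

lift_definition times_laurent :: "'a laurent \<Rightarrow> 'a laurent \<Rightarrow> 'a laurent" is
  "\<lambda>F G \<gamma>. \<Sum>\<alpha> | F \<alpha> \<noteq> 0 \<and> G (\<gamma> - \<alpha>) \<noteq> 0. F \<alpha> * G (\<gamma> - \<alpha>)"
proof -
  fix F G :: "(rat, 'a) vec \<Rightarrow> complex"
  assume FG: "laurent_support {\<alpha>. F \<alpha> \<noteq> 0}" "laurent_support {\<alpha>. G \<alpha> \<noteq> 0}"
  show "laurent_support {\<gamma>. (\<Sum>\<alpha> | F \<alpha> \<noteq> 0 \<and> G (\<gamma> - \<alpha>) \<noteq> 0. F \<alpha> * G (\<gamma> - \<alpha>)) \<noteq> 0}"
  proof (rule laurent_support_subset[OF laurent_support_plus[OF FG]], safe)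
    fix \<gamma> assume "(\<Sum>\<alpha> | F \<alpha> \<noteq> 0 \<and> G (\<gamma> - \<alpha>) \<noteq> 0. F \<alpha> * G (\<gamma> - \<alpha>)) \<noteq> 0"
    then obtain \<alpha> where "F \<alpha> \<noteq> 0 \<and> G (\<gamma> - \<alpha>) \<noteq> 0" using sum.not_neutral_contains_not_neutral by blast
    then show "\<exists>a b. \<gamma> = a + b \<and> a \<in> {\<alpha>. F \<alpha> \<noteq> 0} \<and> b \<in> {\<alpha>. G \<alpha> \<noteq> 0}"
      by (intro exI[of _ \<alpha>] exI[of _ "\<gamma> - \<alpha>"]) auto
  qed
qed

lemma lcoeff_times:
  assumes "finite A" "{\<alpha>. lcoeff F \<alpha> \<noteq> 0 \<and> lcoeff G (\<gamma> - \<alpha>) \<noteq> 0} \<subseteq> A"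
  shows "lcoeff (F * G) \<gamma> = (\<Sum>\<alpha>\<in>A. lcoeff F \<alpha> * lcoeff G (\<gamma> - \<alpha>))"
  unfolding times_laurent.rep_eq using assms by (intro sum.mono_neutral_left) auto

lemma lcoeff_monomial_times: "lcoeff (monomial c \<alpha> * F) \<beta> = c * lcoeff F (\<beta> - \<alpha>)"
  by (subst lcoeff_times[of "{\<alpha>}"]) (auto simp: monomial.rep_eq split: if_splits)

instance
proof
  fix F G H :: "'a laurent"
  show "F + G + H = F + (G + H)" by (rule laurent_eqI) (simp add: plus_laurent.rep_eq)
  show "F + G = G + F" by (rule laurent_eqI) (simp add: plus_laurent.rep_eq)
  show "0 + F = F" by (rule laurent_eqI) (simp add: plus_laurent.rep_eq zero_laurent.rep_eq)
  show "- F + F = 0" by (rule laurent_eqI) (simp add: plus_laurent.rep_eq zero_laurent.rep_eq uminus_laurent.rep_eq)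
  show "F - G = F + - G" by (rule laurent_eqI) (simp add: plus_laurent.rep_eq minus_laurent.rep_eq uminus_laurent.rep_eq)
  show "(0 :: 'a laurent) \<noteq> 1"
  proof
    assume "(0 :: 'a laurent) = 1"
    then have "lcoeff (0 :: 'a laurent) 0 = lcoeff 1 0" by simp
    then show False by (simp add: one_laurent_def zero_laurent.rep_eq monomial.rep_eq)
  qed
  show "1 * F = F" by (rule laurent_eqI) (simp add: one_laurent_def lcoeff_monomial_times)
  show "F * G = G * F"
  proof (rule laurent_eqI)
    fix \<gamma>
    show "lcoeff (F * G) \<gamma> = lcoeff (G * F) \<gamma>"
      unfolding times_laurent.rep_eq
      by (rule sum.reindex_bij_witness[of _ "\<lambda>\<alpha>. \<gamma> - \<alpha>" "\<lambda>\<alpha>. \<gamma> - \<alpha>"]) auto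
  qed
  show "(F + G) * H = F * H + G * H"
  proof (rule laurent_eqI)
    fix \<gamma>
    let ?A = "{\<alpha>. lcoeff F \<alpha> \<noteq> 0 \<and> lcoeff H (\<gamma> - \<alpha>) \<noteq> 0} \<union> {\<alpha>. lcoeff G \<alpha> \<noteq> 0 \<and> lcoeff H (\<gamma> - \<alpha>) \<noteq> 0}"
    have A: "finite ?A" using finite_times_support by blast
    have "lcoeff ((F + G) * H) \<gamma> = (\<Sum>\<alpha>\<in>?A. lcoeff (F + G) \<alpha> * lcoeff H (\<gamma> - \<alpha>))"
      using A by (rule lcoeff_times) (auto simp: plus_laurent.rep_eq)
    moreover have "lcoeff (F * H) \<gamma> = (\<Sum>\<alpha>\<in>?A. lcoeff F \<alpha> * lcoeff H (\<gamma> - \<alpha>))"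
      using A by (rule lcoeff_times) auto
    moreover have "lcoeff (G * H) \<gamma> = (\<Sum>\<alpha>\<in>?A. lcoeff G \<alpha> * lcoeff H (\<gamma> - \<alpha>))"
      using A by (rule lcoeff_times) auto
    ultimately show "lcoeff ((F + G) * H) \<gamma> = lcoeff (F * H + G * H) \<gamma>"
      by (simp add: plus_laurent.rep_eq sum.distrib distrib_right)
  qed
  show "F * G * H = F * (G * H)"
  proof (rule laurent_eqI)
    fix \<gamma>
    let ?S = "{\<alpha>. lcoeff F \<alpha> \<noteq> 0}" and ?T = "{\<alpha>. lcoeff G \<alpha> \<noteq> 0}" and ?U = "{\<alpha>. lcoeff H \<alpha> \<noteq> 0}"
    note ls = laurent_support_lcoeff
    define D where "D = {\<delta> \<in> {a + b | a b. a \<in> ?S \<and> b \<in> ?T}. \<gamma> - \<delta> \<in> ?U}"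
    define A where "A = {\<alpha> \<in> ?S. \<gamma> - \<alpha> \<in> {a + b | a b. a \<in> ?T \<and> b \<in> ?U}}"
    have fD: "finite D" unfolding D_def by (intro laurent_support_finite_decomp laurent_support_plus ls)
    have fA: "finite A" unfolding A_def by (intro laurent_support_finite_decomp laurent_support_plus ls)
    have supp: "\<exists>a b. \<delta> = a + b \<and> a \<in> {\<alpha>. lcoeff X \<alpha> \<noteq> 0} \<and> b \<in> {\<alpha>. lcoeff Y \<alpha> \<noteq> 0}"
      if nz: "lcoeff (X * Y) \<delta> \<noteq> 0" for X Y :: "'a laurent" and \<delta>
    proof -
      obtain \<alpha> where "lcoeff X \<alpha> \<noteq> 0 \<and> lcoeff Y (\<delta> - \<alpha>) \<noteq> 0"
        using nz sum.not_neutral_contains_not_neutral unfolding times_laurent.rep_eq by blast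
      then show ?thesis by (intro exI[of _ \<alpha>] exI[of _ "\<delta> - \<alpha>"]) auto
    qed
    have "lcoeff (F * G * H) \<gamma> = (\<Sum>\<delta>\<in>D. lcoeff (F * G) \<delta> * lcoeff H (\<gamma> - \<delta>))"
      using fD by (rule lcoeff_times) (use supp D_def in blast)
    also have "\<dots> = (\<Sum>\<delta>\<in>D. \<Sum>\<alpha>\<in>A. lcoeff F \<alpha> * lcoeff G (\<delta> - \<alpha>) * lcoeff H (\<gamma> - \<delta>))"
    proof (rule sum.cong[OF refl])
      fix \<delta> assume d: "\<delta> \<in> D"
      have "lcoeff (F * G) \<delta> = (\<Sum>\<alpha>\<in>A. lcoeff F \<alpha> * lcoeff G (\<delta> - \<alpha>))"
      proof (rule lcoeff_times[OF fA], safe)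
        fix \<alpha> assume a: "lcoeff F \<alpha> \<noteq> 0" "lcoeff G (\<delta> - \<alpha>) \<noteq> 0"
        have "\<gamma> - \<alpha> = (\<delta> - \<alpha>) + (\<gamma> - \<delta>)" by simp
        then show "\<alpha> \<in> A" using a d unfolding A_def D_def by blast
      qed
      then show "lcoeff (F * G) \<delta> * lcoeff H (\<gamma> - \<delta>) = (\<Sum>\<alpha>\<in>A. lcoeff F \<alpha> * lcoeff G (\<delta> - \<alpha>) * lcoeff H (\<gamma> - \<delta>))"
        by (simp add: sum_distrib_right)
    qed
    also have "\<dots> = (\<Sum>\<alpha>\<in>A. \<Sum>\<delta>\<in>D. lcoeff F \<alpha> * lcoeff G (\<delta> - \<alpha>) * lcoeff H (\<gamma> - \<delta>))"
      by (rule sum.swap)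
    also have "\<dots> = (\<Sum>\<alpha>\<in>A. lcoeff F \<alpha> * lcoeff (G * H) (\<gamma> - \<alpha>))"
    proof (rule sum.cong[OF refl])
      fix \<alpha> assume a: "\<alpha> \<in> A"
      have "lcoeff (G * H) (\<gamma> - \<alpha>) = (\<Sum>\<beta>\<in>(\<lambda>\<delta>. \<delta> - \<alpha>) ` D. lcoeff G \<beta> * lcoeff H (\<gamma> - \<alpha> - \<beta>))"
      proof (rule lcoeff_times, use fD in simp, safe)
        fix \<beta> assume b: "lcoeff G \<beta> \<noteq> 0" "lcoeff H (\<gamma> - \<alpha> - \<beta>) \<noteq> 0"
        have "\<alpha> + \<beta> \<in> D" unfolding D_def using a b A_def by (auto simp: diff_diff_eq)
        moreover have "\<beta> = \<alpha> + \<beta> - \<alpha>" by simp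
        ultimately show "\<beta> \<in> (\<lambda>\<delta>. \<delta> - \<alpha>) ` D" by blast
      qed
      also have "\<dots> = (\<Sum>\<delta>\<in>D. lcoeff G (\<delta> - \<alpha>) * lcoeff H (\<gamma> - \<delta>))"
        by (subst sum.reindex) (auto simp: inj_on_def)
      finally show "(\<Sum>\<delta>\<in>D. lcoeff F \<alpha> * lcoeff G (\<delta> - \<alpha>) * lcoeff H (\<gamma> - \<delta>)) = lcoeff F \<alpha> * lcoeff (G * H) (\<gamma> - \<alpha>)"
        by (simp add: sum_distrib_left mult.assoc)
    qed
    also have "\<dots> = lcoeff (F * (G * H)) \<gamma>"
      using supp by (intro lcoeff_times[symmetric] fA) (unfold A_def, blast)
    finally show "lcoeff (F * G * H) \<gamma> = lcoeff (F * (G * H)) \<gamma>" .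
  qed
qed

end

lemma monomial_mult: "monomial a \<alpha> * monomial b \<beta> = monomial (a * b) (\<alpha> + \<beta>)"
  by (rule laurent_eqI) (auto simp: lcoeff_monomial_times monomial.rep_eq diff_eq_eq add.commute)

subsection \<open>Inverses\<close>

lemma ex_geometric_inverse:
  assumes pos: "\<And>\<alpha>. lcoeff H \<alpha> \<noteq> 0 \<Longrightarrow> small \<alpha>"
  shows "\<exists>G. (1 - H) * G = 1"
proof -
  define S where "S = {\<alpha>. lcoeff H \<alpha> \<noteq> 0}"
  define W where "W = sums_of (+) 0 S"
  have lS: "laurent_support S" unfolding S_def by (rule laurent_support_lcoeff)
  have lW: "laurent_support W" unfolding W_def using pos by (intro laurent_support_sums_of lS) (simp add: S_def)
  have W0: "0 \<in> W" unfolding W_def by (rule sums_of.zero)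
  have Wadd: "s + x \<in> W" if "s \<in> S" "x \<in> W" for s x using that unfolding W_def by (rule sums_of.add)
  define R where "R = {(a, b). a \<in> W \<and> b \<in> W \<and> lex_less a b}"
  have "wf R"
    unfolding wf_iff_no_infinite_down_chain R_def
    using lW unfolding laurent_support_iff lex.wo_set_iff_no_descent by fast
  define \<Phi> where "\<Phi> = (\<lambda>(g :: (rat, 'a) vec \<Rightarrow> complex) \<gamma>. if \<gamma> \<notin> W then 0 else
      (if \<gamma> = 0 then 1 else 0) + (\<Sum>\<sigma> | \<sigma> \<in> S \<and> \<gamma> - \<sigma> \<in> W. lcoeff H \<sigma> * g (\<gamma> - \<sigma>)))"
  define g where "g = wfrec R \<Phi>"
  have g: "g \<gamma> = \<Phi> g \<gamma>" for \<gamma>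
  proof -
    have "g \<gamma> = \<Phi> (cut g R \<gamma>) \<gamma>" unfolding g_def by (rule wfrec[OF \<open>wf R\<close>])
    also have "\<dots> = \<Phi> g \<gamma>"
    proof (cases "\<gamma> \<in> W")
      case True
      have "cut g R \<gamma> (\<gamma> - \<sigma>) = g (\<gamma> - \<sigma>)" if "\<sigma> \<in> S" "\<gamma> - \<sigma> \<in> W" for \<sigma>
        using that True pos by (intro cut_apply) (simp add: R_def lex_less_def S_def)
      then show ?thesis by (simp add: \<Phi>_def)
    qed (simp add: \<Phi>_def)
    finally show ?thesis .
  qed
  have gW: "g \<gamma> = 0" if "\<gamma> \<notin> W" for \<gamma> using g[of \<gamma>] that by (simp add: \<Phi>_def)
  have "laurent_support {\<alpha>. g \<alpha> \<noteq> 0}" using gW by (intro laurent_support_subset[OF lW]) blast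
  then obtain G where G: "lcoeff G = g" using Abs_laurent_inverse[of g] by blast
  have "G = 1 + H * G"
  proof (rule laurent_eqI)
    fix \<gamma>
    have fin: "finite {\<sigma>. \<sigma> \<in> S \<and> \<gamma> - \<sigma> \<in> W}"
      using laurent_support_finite_decomp[OF lS lW] by simp
    have HG: "lcoeff (H * G) \<gamma> = (\<Sum>\<sigma> | \<sigma> \<in> S \<and> \<gamma> - \<sigma> \<in> W. lcoeff H \<sigma> * g (\<gamma> - \<sigma>))"
      unfolding G[symmetric] using gW by (intro lcoeff_times fin) (auto simp: S_def G)
    show "lcoeff G \<gamma> = lcoeff (1 + H * G) \<gamma>"
    proof (cases "\<gamma> \<in> W")
      case True
      then show ?thesis using g[of \<gamma>]
        by (simp add: plus_laurent.rep_eq HG G \<Phi>_def one_laurent_def monomial.rep_eq)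
    next
      case False
      then have "{\<sigma>. \<sigma> \<in> S \<and> \<gamma> - \<sigma> \<in> W} = {}" using Wadd[of _ "\<gamma> - _"] by force
      moreover have "\<gamma> \<noteq> 0" using False W0 by blast
      ultimately show ?thesis using gW[OF False]
        by (simp only: plus_laurent.rep_eq HG G one_laurent_def monomial.rep_eq) simp
    qed
  qed
  then have "(1 - H) * G = 1" by (simp add: left_diff_distrib algebra_simps)
  then show ?thesis by blast
qed

lemma ex_inverse_laurent:
  fixes F :: "'v::{finite,linorder} laurent"
  assumes "F \<noteq> 0"
  shows "\<exists>G. F * G = 1"
proof -
  have "{\<alpha>. lcoeff F \<alpha> \<noteq> 0} \<noteq> {}"
    using assms laurent_eqI[of F 0] by (auto simp: zero_laurent.rep_eq)
  moreover have "wo_set lex_le {\<alpha>. lcoeff F \<alpha> \<noteq> 0}"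
    using laurent_support_lcoeff[of F] unfolding laurent_support_iff by blast
  ultimately obtain m where m: "lcoeff F m \<noteq> 0" "\<And>\<alpha>. lcoeff F \<alpha> \<noteq> 0 \<Longrightarrow> lex_le m \<alpha>"
    unfolding wo_set_def by blast
  define E where "E = monomial (1 / lcoeff F m) (- m)"
  define H where "H = 1 - E * F"
  have cH: "lcoeff H \<beta> = (if \<beta> = 0 then 1 else 0) - lcoeff F (\<beta> + m) / lcoeff F m" for \<beta>
    by (simp add: H_def E_def minus_laurent.rep_eq one_laurent_def monomial.rep_eq lcoeff_monomial_times)
  have "small \<beta>" if nz: "lcoeff H \<beta> \<noteq> 0" for \<beta>
  proof -
    have b: "\<beta> \<noteq> 0" using nz m(1) by (auto simp: cH)
    then have "lcoeff F (\<beta> + m) \<noteq> 0" using nz by (auto simp: cH)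
    then show ?thesis using m(2)[of "\<beta> + m"] b by (auto simp: lex_le_def)
  qed
  then obtain G where "(1 - H) * G = 1" using ex_geometric_inverse by blast
  then have "F * (E * G) = 1" by (simp add: H_def ac_simps)
  then show ?thesis by blast
qed

instantiation laurent :: ("{finite,linorder}") field
begin

definition inverse_laurent :: "'a laurent \<Rightarrow> 'a laurent" where
  "inverse_laurent F = (if F = 0 then 0 else (THE G. F * G = 1))"

definition divide_laurent :: "'a laurent \<Rightarrow> 'a laurent \<Rightarrow> 'a laurent" where
  "divide_laurent F G = F * inverse G"

instance
proof
  fix F G :: "'a laurent"
  show "inverse F * F = 1" if F: "F \<noteq> 0"
  proof -
    obtain G where G: "F * G = 1" using ex_inverse_laurent[OF F] by blast
    have "G' = G" if "F * G' = 1" for G'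
    proof -
      have "G' = G' * (F * G)" using G by simp
      also have "\<dots> = (F * G') * G" by (simp only: ac_simps)
      finally show ?thesis using that by simp
    qed
    then have "(THE G. F * G = 1) = G" using G by (intro the_equality)
    then show ?thesis using F G by (simp add: inverse_laurent_def mult.commute)
  qed
  show "F div G = F * inverse G" by (rule divide_laurent_def)
  show "inverse (0 :: 'a laurent) = 0" by (simp add: inverse_laurent_def)
qed

end

lemma of_nat_laurent: "of_nat k = monomial (of_nat k) 0"
proof (induction k)
  case 0
  show ?case by (rule laurent_eqI) (simp add: zero_laurent.rep_eq monomial.rep_eq)
next
  case (Suc k)
  then show ?case by (intro laurent_eqI) (simp add: plus_laurent.rep_eq one_laurent_def monomial.rep_eq)
qed

instance laurent :: ("{finite,linorder}") field_char_0
proof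
  show "inj (of_nat :: nat \<Rightarrow> 'a laurent)"
  proof (rule injI)
    fix k l assume "(of_nat k :: 'a laurent) = of_nat l"
    then have "lcoeff (monomial (of_nat k) 0 :: 'a laurent) 0 = lcoeff (monomial (of_nat l) 0 :: 'a laurent) 0"
      by (simp add: of_nat_laurent)
    then show "k = l" by (simp add: monomial.rep_eq)
  qed
qed


subsection \<open>Expansion of geometric series\<close>

lemma large_iff: "large \<alpha> \<longleftrightarrow> small (- \<alpha>)"
  unfolding large_def using small_cases[of \<alpha>] small_uminus[of "- \<alpha>"] by auto

lemma one_minus_monomial_nonzero:
  assumes "\<alpha> \<noteq> 0" shows "1 - monomial \<zeta> \<alpha> \<noteq> 0"
proof
  assume z: "1 - monomial \<zeta> \<alpha> = 0"
  have "lcoeff (1 - monomial \<zeta> \<alpha>) 0 = 1"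
    using assms by (simp add: minus_laurent.rep_eq one_laurent_def monomial.rep_eq)
  then show False unfolding z by (simp add: zero_laurent.rep_eq)
qed

lemma lcoeff_geometric_small:
  assumes \<alpha>: "small \<alpha>"
  shows "lcoeff (1 / (1 - monomial \<zeta> \<alpha>)) (of_nat t *s \<alpha>) = \<zeta> ^ t"
    and "(\<And>t. \<beta> \<noteq> of_nat t *s \<alpha>) \<Longrightarrow> lcoeff (1 / (1 - monomial \<zeta> \<alpha>)) \<beta> = 0"
proof -
  define G where "G = 1 / (1 - monomial \<zeta> \<alpha>)"
  have a0: "\<alpha> \<noteq> 0" using \<alpha> by auto
  have "(1 - monomial \<zeta> \<alpha>) * G = 1"
    using one_minus_monomial_nonzero[OF a0] by (simp add: G_def)
  then have eq: "G = 1 + monomial \<zeta> \<alpha> * G" by (simp add: algebra_simps)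
  have rec: "lcoeff G \<beta> = (if \<beta> = 0 then 1 else 0) + \<zeta> * lcoeff G (\<beta> - \<alpha>)" for \<beta>
  proof -
    have "lcoeff G \<beta> = lcoeff (1 + monomial \<zeta> \<alpha> * G) \<beta>" by (rule arg_cong[OF eq])
    also have "\<dots> = (if \<beta> = 0 then 1 else 0) + \<zeta> * lcoeff G (\<beta> - \<alpha>)"
      by (simp add: plus_laurent.rep_eq lcoeff_monomial_times one_laurent_def monomial.rep_eq)
    finally show ?thesis .
  qed
  have step: "of_nat (Suc k) *s \<alpha> = of_nat k *s \<alpha> + \<alpha>" for k
    by (simp add: vec_eq_iff algebra_simps)
  have step_nz: "of_nat (Suc k) *s \<alpha> \<noteq> 0" for k
    using a0 by (simp del: of_nat_Suc add: vector_mul_eq_0)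
  have zero: "lcoeff G \<beta> = 0" if \<beta>: "\<And>t. \<beta> \<noteq> of_nat t *s \<alpha>" for \<beta>
  proof (rule ccontr)
    assume nz: "lcoeff G \<beta> \<noteq> 0"
    have "lcoeff G (\<beta> - of_nat k *s \<alpha>) \<noteq> 0" for k
    proof (induction k)
      case (Suc k)
      have "\<beta> - of_nat k *s \<alpha> \<noteq> 0" using \<beta>[of k] by simp
      then have "lcoeff G (\<beta> - of_nat k *s \<alpha> - \<alpha>) \<noteq> 0" using Suc rec[of "\<beta> - of_nat k *s \<alpha>"] by auto
      then show ?case by (simp only: step diff_diff_eq) simp
    qed (simp add: nz)
    moreover have "lex_less (\<beta> - of_nat (Suc k) *s \<alpha>) (\<beta> - of_nat k *s \<alpha>)" for k
      using \<alpha> unfolding lex_less_def step by simp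
    ultimately have "\<exists>x. \<forall>k::nat. x k \<in> {\<alpha>. lcoeff G \<alpha> \<noteq> 0} \<and> lex_less (x (Suc k)) (x k)"
      by (intro exI[of _ "\<lambda>k. \<beta> - of_nat k *s \<alpha>"]) auto
    then show False
      using laurent_support_lcoeff[of G] unfolding laurent_support_iff lex.wo_set_iff_no_descent by blast
  qed
  then show "(\<And>t. \<beta> \<noteq> of_nat t *s \<alpha>) \<Longrightarrow> lcoeff (1 / (1 - monomial \<zeta> \<alpha>)) \<beta> = 0"
    by (simp add: G_def)
  have "lcoeff G (of_nat t *s \<alpha>) = \<zeta> ^ t"
  proof (induction t)
    case 0
    have "lcoeff G (- \<alpha>) = 0"
    proof (rule zero)
      fix t
      show "- \<alpha> \<noteq> of_nat t *s \<alpha>" using step_nz[of t] unfolding step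
        by (metis add.left_inverse)
    qed
    then show ?case using rec[of 0] by simp
  next
    case (Suc t)
    have "of_nat (Suc t) *s \<alpha> - \<alpha> = of_nat t *s \<alpha>" unfolding step by simp
    then show ?case using rec[of "of_nat (Suc t) *s \<alpha>"] step_nz[of t] Suc by (simp del: of_nat_Suc)
  qed
  then show "lcoeff (1 / (1 - monomial \<zeta> \<alpha>)) (of_nat t *s \<alpha>) = \<zeta> ^ t"
    by (simp add: G_def)
qed

lemma geometric_large:
  assumes "large \<alpha>" "\<zeta> \<noteq> 0"
  shows "1 / (1 - monomial \<zeta> \<alpha>) = - (monomial (1 / \<zeta>) (- \<alpha>) * (1 / (1 - monomial (1 / \<zeta>) (- \<alpha>))))"
proof -
  define x y where "x = monomial \<zeta> \<alpha>" and "y = monomial (1 / \<zeta>) (- \<alpha>)"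
  have a0: "\<alpha> \<noteq> 0" using assms(1) by (simp add: large_def)
  have xy: "x * y = 1" using assms(2) by (simp add: x_def y_def monomial_mult one_laurent_def)
  have nz: "1 - x \<noteq> 0" "1 - y \<noteq> 0"
    unfolding x_def y_def using a0 by (intro one_minus_monomial_nonzero; simp)+
  have "(1 - x) * (- y) = 1 - y" using xy by (simp add: algebra_simps)
  then have "1 / (1 - x) = - (y * (1 / (1 - y)))" using nz by (simp add: field_simps)
  then show ?thesis by (simp add: x_def y_def)
qed

subsection \<open>Extraction operators\<close>

lift_definition CT :: "'v::{finite,linorder} \<Rightarrow> 'v laurent \<Rightarrow> 'v laurent" is
  "\<lambda>v F \<alpha>. if \<alpha> $ v = 0 then F \<alpha> else 0"
  by (erule laurent_support_subset) auto

lift_definition integral_part :: "'v::{finite,linorder} \<Rightarrow> 'v laurent \<Rightarrow> 'v laurent" is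
  "\<lambda>v F \<alpha>. if \<alpha> $ v \<in> \<int> then F \<alpha> else 0"
  by (erule laurent_support_subset) auto


section \<open>Matrix forms\<close>

text \<open>
  The types \<open>'n\<close> and \<open>'r\<close> play the roles of \<open>[n]\<close> and \<open>[r]\<close>. \<open>Yvar j\<close> is the variable \<open>y\<^sub>j\<close> and the
  matrix row \<open>j\<close>, \<open>Lvar i\<close> is the variable \<open>\<lambda>\<^sub>i\<close> and the matrix row \<open>n + i\<close>. Column \<open>j \<in> [n]\<close> is
  indexed by \<open>Some j\<close>, column \<open>n + 1\<close> by \<open>None\<close>.
\<close>

datatype ('n, 'r) variable = Yvar 'n | Lvar 'r

instance variable :: (finite, finite) finite
proof
  have "(UNIV :: ('a, 'b) variable set) = range Yvar \<union> range Lvar"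
  proof -
    have "v \<in> range Yvar \<union> range Lvar" for v :: "('a, 'b) variable" by (cases v) auto
    then show ?thesis by blast
  qed
  moreover have "finite (range Yvar \<union> range Lvar :: ('a, 'b) variable set)" by simp
  ultimately show "finite (UNIV :: ('a, 'b) variable set)" by (rule ssubst)
qed

instantiation variable :: (linorder, linorder) linorder
begin

fun less_eq_variable :: "('a, 'b) variable \<Rightarrow> ('a, 'b) variable \<Rightarrow> bool" where
  "less_eq_variable (Yvar j) (Yvar k) \<longleftrightarrow> j \<le> k"
| "less_eq_variable (Yvar j) (Lvar i) \<longleftrightarrow> True"
| "less_eq_variable (Lvar i) (Yvar j) \<longleftrightarrow> False"
| "less_eq_variable (Lvar i) (Lvar l) \<longleftrightarrow> i \<le> l"

definition less_variable :: "('a, 'b) variable \<Rightarrow> ('a, 'b) variable \<Rightarrow> bool" where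
  "less_variable u v \<longleftrightarrow> u \<le> v \<and> \<not> v \<le> u"

instance
proof
  fix u v w :: "('a, 'b) variable"
  show "u < v \<longleftrightarrow> u \<le> v \<and> \<not> v \<le> u" by (rule less_variable_def)
  show "u \<le> u" by (cases u) auto
  show "u \<le> v \<Longrightarrow> v \<le> w \<Longrightarrow> u \<le> w" by (cases u; cases v; cases w) auto
  show "u \<le> v \<Longrightarrow> v \<le> u \<Longrightarrow> u = v" by (cases u; cases v) auto
  show "u \<le> v \<or> v \<le> u" by (cases u; cases v) auto
qed

end

type_synonym ('n, 'r) form_matrix = "((rat, 'n option) vec, ('n, 'r) variable) vec"

definition initial_matrix ::
  "int ^ 'n ^ 'r \<Rightarrow> int ^ 'r \<Rightarrow> ('n::finite, 'r::finite) form_matrix" where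
  "initial_matrix A b = (\<chi> u s. case u of
       Yvar k \<Rightarrow> if s = Some k then 1 else 0
     | Lvar i \<Rightarrow> (case s of Some j \<Rightarrow> of_int (A $ i $ j) | None \<Rightarrow> - of_int (b $ i)))"

definition pivot :: "('n::finite, 'r::finite) form_matrix \<Rightarrow> 'r \<Rightarrow> 'n \<Rightarrow> ('n, 'r) form_matrix" where
  "pivot P i j = (\<chi> u s. if s = Some j then P $ u $ s
     else P $ u $ s - P $ Lvar i $ s / P $ Lvar i $ Some j * P $ u $ Some j)"

text \<open>\<open>pivots M k I J P\<close>: \<open>P\<close> is a well-defined matrix \<open>M\<^sub>k\<langle>I;J\<rangle>\<close>.\<close>

inductive pivots :: "('n::finite, 'r::finite) form_matrix \<Rightarrow> nat \<Rightarrow> 'r set \<Rightarrow> 'n set \<Rightarrow>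
    ('n, 'r) form_matrix \<Rightarrow> bool" for M where
  start: "pivots M 0 {} {} M"
| step: "pivots M k I J P \<Longrightarrow> i \<notin> I \<Longrightarrow> j \<notin> J \<Longrightarrow> P $ Lvar i $ Some j \<noteq> 0 \<Longrightarrow>
    pivots M (Suc k) (insert i I) (insert j J) (pivot P i j)"

text \<open>Omitting the entries of the ignored rows amounts to making the exponents of these variables zero.\<close>

definition exponent :: "'r set \<Rightarrow> ('n::finite, 'r::finite) form_matrix \<Rightarrow> 'n option \<Rightarrow> (rat, ('n, 'r) variable) vec" where
  "exponent I P s = (\<chi> u. if u \<in> Lvar ` I then 0 else P $ u $ s)"

definition bracket :: "'r set \<Rightarrow> 'n set \<Rightarrow> ('n::{finite,linorder}, 'r::{finite,linorder}) form_matrix \<Rightarrow>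
    ('n, 'r) variable laurent" where
  "bracket I J P = monomial 1 (exponent I P None) / (\<Prod>j\<in>UNIV - J. 1 - monomial 1 (exponent I P (Some j)))"

definition contributing ::
  "'r set \<Rightarrow> ('n::{finite,linorder}, 'r::{finite,linorder}) form_matrix \<Rightarrow> 'r \<Rightarrow> 'n \<Rightarrow> bool" where
  "contributing I P i j \<longleftrightarrow> (let \<gamma> = exponent I P (Some j); b = \<gamma> $ Lvar i in b \<noteq> 0 \<and> small (b *s \<gamma>))"

definition dually_contributing ::
  "'r set \<Rightarrow> ('n::{finite,linorder}, 'r::{finite,linorder}) form_matrix \<Rightarrow> 'r \<Rightarrow> 'n \<Rightarrow> bool" where
  "dually_contributing I P i j \<longleftrightarrow> (let \<gamma> = exponent I P (Some j); b = \<gamma> $ Lvar i in b \<noteq> 0 \<and> large (b *s \<gamma>))"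

definition lambda_degree ::
  "'r set \<Rightarrow> 'n set \<Rightarrow> ('n::finite, 'r::finite) form_matrix \<Rightarrow> 'r \<Rightarrow> rat" where
  "lambda_degree I J P i = exponent I P None $ Lvar i
     - (\<Sum>j | j \<notin> J \<and> exponent I P (Some j) $ Lvar i > 0. exponent I P (Some j) $ Lvar i)"

definition lambda_pole_order ::
  "'r set \<Rightarrow> 'n set \<Rightarrow> ('n::finite, 'r::finite) form_matrix \<Rightarrow> 'r \<Rightarrow> rat" where
  "lambda_pole_order I J P i = - (exponent I P None $ Lvar i)
     + (\<Sum>j | j \<notin> J \<and> exponent I P (Some j) $ Lvar i < 0. exponent I P (Some j) $ Lvar i)"

definition c_plus ::
  "'r set \<Rightarrow> 'n set \<Rightarrow> ('n::{finite,linorder}, 'r::{finite,linorder}) form_matrix \<Rightarrow> 'r \<Rightarrow> enat" where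
  "c_plus I J P i = (if lambda_degree I J P i < 0
     then enat (card {j. j \<notin> J \<and> contributing I P i j}) else \<infinity>)"

definition c_minus ::
  "'r set \<Rightarrow> 'n set \<Rightarrow> ('n::{finite,linorder}, 'r::{finite,linorder}) form_matrix \<Rightarrow> 'r \<Rightarrow> enat" where
  "c_minus I J P i = (if lambda_pole_order I J P i < 0
     then enat (card {j. j \<notin> J \<and> dually_contributing I P i j}) else \<infinity>)"

end

theory Submission
  imports Defs
begin

text \<open>
  Every variable \<open>y\<^sub>s\<close> with \<open>s \<notin> J\<close> occurs only in column \<open>s\<close>, with exponent \<open>1\<close>. Hence after
  expanding all geometric series the monomials are indexed without repetition by their exponents
  \<open>t\<^sub>s\<close> of \<open>y\<^sub>s\<close>, on both sides of the claim, and it suffices to compare coefficients in \<open>{-1, 0, 1}\<close>.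
  For \<open>b\<^sub>s \<noteq> 0\<close> put \<open>u\<^sub>s = \<gamma>\<^sub>s / b\<^sub>s\<close>. The \<open>s\<close>-th factor of the coefficient is \<open>e\<^sub>s(0)\<close> on the
  left and \<open>e\<^sub>s(u\<^sub>j)\<close> in the \<open>j\<close>-th summand on the right, where \<open>e\<^sub>s\<close> is a step function on the
  lexicographically ordered exponents whose only jump is \<open>- sgn b\<^sub>s\<close> at \<open>u\<^sub>s\<close>. So the sum over the
  contributing columns, those with \<open>u\<^sub>j > 0\<close>, telescopes to the difference of \<open>\<Prod>\<^sub>s e\<^sub>s\<close> between \<open>0\<close>
  and \<open>+\<infinity>\<close>, and the degree condition makes the value at \<open>+\<infinity>\<close> vanish. Dually for \<open>-\<infinity>\<close>.
\<close>

section \<open>Telescoping products of step functions\<close>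

text \<open>Factor \<open>s\<close> is a step with value \<open>f s\<close> below \<open>u s\<close>
  and \<open>g s\<close> from \<open>u s\<close> on. By injectivity the steps switch one at a time,
  so moving \<open>p\<close> upwards past all of them changes the product by one jump after another.
  An arbitrary linear order is taken because the reversed order is used too.\<close>

lemma (in linorder) prod_step_telescope:
  fixes f g :: "'b \<Rightarrow> 'c::comm_ring_1" and u :: "'b \<Rightarrow> 'a"
  assumes "finite S" "inj_on u S"
  shows "(\<Prod>s\<in>S. if p < u s then f s else g s) - (\<Prod>s\<in>S. g s) =
    (\<Sum>j | j \<in> S \<and> p < u j. (f j - g j) * (\<Prod>s\<in>S - {j}. if u j < u s then f s else g s))"
  using assms
proof (induction S rule: finite_psubset_induct)
  case (psubset S)
  show ?case
  proof (cases "\<exists>s\<in>S. p < u s")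
    case False
    then have "{j. j \<in> S \<and> p < u j} = {}" by blast
    moreover have "(\<Prod>s\<in>S. if p < u s then f s else g s) = (\<Prod>s\<in>S. g s)"
      using False by (intro prod.cong) auto
    ultimately show ?thesis by (simp only: sum.empty diff_self)
  next
    case True
    then have ne: "u ` S \<noteq> {}" by blast
    have fin: "finite S" by (rule psubset.hyps)
    \<comment> \<open>The topmost step is removed: its own summand sees all other steps already
      switched, and every other summand sees it unswitched, as the constant factor
      \<open>f m\<close>.\<close>
    obtain m where m: "m \<in> S" "u m = Max (u ` S)"
      using Max_in[OF finite_imageI[OF fin] ne] by auto
    have mge: "u s \<le> u m" if "s \<in> S" for s
      unfolding m(2) using that fin by (intro Max_ge) auto
    define R where "R = S - {m}"
    have R: "S = insert m R" "m \<notin> R" "finite R" using m(1) fin by (auto simp: R_def)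
    have less: "u s < u m" if "s \<in> R" for s
      using that mge[of s] psubset.prems m(1) unfolding R_def inj_on_def
      by (metis Diff_iff insertI1 order.not_eq_order_implies_strict)
    have pm: "p < u m" using True mge less_le_trans by blast
    let ?e = "\<lambda>q s. if q < u s then f s else g s"
    have IH: "prod (?e p) R - prod g R =
        (\<Sum>j | j \<in> R \<and> p < u j. (f j - g j) * prod (?e (u j)) (R - {j}))"
      using R m(1) psubset.prems by (intro psubset.IH) (auto intro: inj_on_subset)
    have idx: "{j. j \<in> S \<and> p < u j} = insert m {j. j \<in> R \<and> p < u j}"
      using pm R(1) by blast
    have top: "prod (?e (u m)) (S - {m}) = prod g R"
      unfolding R_def[symmetric] by (intro prod.cong) (use less in \<open>auto dest: less_not_sym\<close>)
    have rest: "prod (?e (u j)) (S - {j}) = f m * prod (?e (u j)) (R - {j})" if j: "j \<in> R" for j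
    proof -
      have "S - {j} = insert m (R - {j})" using R(1,2) j by blast
      then show ?thesis using R(2,3) less[OF j] by simp
    qed
    have "(\<Sum>j | j \<in> S \<and> p < u j. (f j - g j) * prod (?e (u j)) (S - {j})) =
        (f m - g m) * prod g R + (\<Sum>j | j \<in> R \<and> p < u j. (f j - g j) * prod (?e (u j)) (S - {j}))"
      unfolding idx using R(2,3) top by simp
    also have "(\<Sum>j | j \<in> R \<and> p < u j. (f j - g j) * prod (?e (u j)) (S - {j})) =
        f m * (\<Sum>j | j \<in> R \<and> p < u j. (f j - g j) * prod (?e (u j)) (R - {j}))"
      unfolding sum_distrib_left by (intro sum.cong refl) (simp add: rest ac_simps)
    also have "\<dots> = f m * (prod (?e p) R - prod g R)" by (simp only: IH)
    also have "(f m - g m) * prod g R + \<dots> = prod (?e p) S - prod g S"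
      using R pm by (simp add: algebra_simps)
    finally show ?thesis by simp
  qed
qed

section \<open>Coefficients of products of geometric series\<close>

text \<open>For nonzero \<gamma> and integral \<open>t\<close>, this is the coefficient of
  \<open>t *s \<gamma>\<close> in the expansion of 1/(1 - x^\<gamma>). The argument is rational
  because it is later read off as an entry of an exponent vector.\<close>

definition geometric_coeff :: "rat ^ 'v::{finite,linorder} \<Rightarrow> rat \<Rightarrow> complex" where
  "geometric_coeff \<gamma> t = (if small \<gamma> then of_bool (0 \<le> t) else - of_bool (t < 0))"

lemma lcoeff_geometric:
  fixes \<gamma> :: "rat ^ 'v::{finite,linorder}"
  assumes "\<gamma> \<noteq> 0"
  shows "lcoeff (1 / (1 - monomial 1 \<gamma>)) (of_int t *s \<gamma>) = geometric_coeff \<gamma> (of_int t)"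
    and "(\<And>t. \<beta> \<noteq> of_int t *s \<gamma>) \<Longrightarrow> lcoeff (1 / (1 - monomial 1 \<gamma>)) \<beta> = 0"
proof -
  have small_case: "lcoeff (1 / (1 - monomial 1 \<delta>)) (of_int t *s \<delta>) = of_bool (0 \<le> t)"
    if "small \<delta>" for \<delta> :: "(rat, 'v) vec" and t :: int
  proof (cases "0 \<le> t")
    case True
    then show ?thesis using lcoeff_geometric_small(1)[OF that, of 1 "nat t"] by simp
  next
    case False
    have "of_int t *s \<delta> \<noteq> of_nat n *s \<delta>" for n
    proof -
      have "(of_int t :: rat) \<noteq> of_nat n"
        using False by (metis of_int_eq_iff of_int_of_nat_eq of_nat_0_le_iff)
      moreover have "\<delta> \<noteq> 0" using that by auto
      ultimately show ?thesis by (simp add: vector_mul_rcancel)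
    qed
    then show ?thesis using lcoeff_geometric_small(2)[OF that] False by simp
  qed
  have large_case: "lcoeff (1 / (1 - monomial 1 \<gamma>)) \<beta> =
      - lcoeff (1 / (1 - monomial 1 (- \<gamma>))) (\<beta> + \<gamma>)" if "\<not> small \<gamma>" for \<beta>
  proof -
    have "1 / (1 - monomial 1 \<gamma>) = - (monomial 1 (- \<gamma>) * (1 / (1 - monomial 1 (- \<gamma>))))"
      using geometric_large[of \<gamma> 1] assms that by (simp add: large_def)
    then show ?thesis by (simp only: uminus_laurent.rep_eq lcoeff_monomial_times) simp
  qed
  show "lcoeff (1 / (1 - monomial 1 \<gamma>)) (of_int t *s \<gamma>) = geometric_coeff \<gamma> (of_int t)"
  proof (cases "small \<gamma>")
    case True
    then show ?thesis by (simp add: small_case geometric_coeff_def)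
  next
    case False
    then have "small (- \<gamma>)" using small_cases[OF assms] by blast
    \<comment> \<open>The prefactor x^(-\<gamma>) shifts the index by one, so the nonnegative powers
      of x^(-\<gamma>) match exactly the \<open>t < 0\<close>.\<close>
    moreover have "of_int t *s \<gamma> + \<gamma> = of_int (- t - 1) *s (- \<gamma>)"
      by (simp add: vec_eq_iff algebra_simps)
    ultimately have "lcoeff (1 / (1 - monomial 1 (- \<gamma>))) (of_int t *s \<gamma> + \<gamma>) = of_bool (0 \<le> - t - 1)"
      using small_case[of "- \<gamma>" "- t - 1"] by (simp only:)
    then show ?thesis using False by (simp add: large_case geometric_coeff_def)
  qed
  assume \<beta>: "\<And>t. \<beta> \<noteq> of_int t *s \<gamma>"
  show "lcoeff (1 / (1 - monomial 1 \<gamma>)) \<beta> = 0"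
  proof (cases "small \<gamma>")
    case True
    then show ?thesis using \<beta>[of "int _"] by (intro lcoeff_geometric_small(2)) simp_all
  next
    case False
    then have "small (- \<gamma>)" using small_cases[OF assms] by blast
    moreover have "\<beta> + \<gamma> \<noteq> of_nat n *s (- \<gamma>)" for n
    proof
      assume "\<beta> + \<gamma> = of_nat n *s (- \<gamma>)"
      then have "\<beta> = of_int (- int n - 1) *s \<gamma>" by (simp add: vec_eq_iff algebra_simps)
      then show False using \<beta> by blast
    qed
    ultimately show ?thesis using False by (simp add: large_case lcoeff_geometric_small(2))
  qed
qed

text \<open>At coordinate \<open>v s\<close> only \<open>\<gamma> s\<close> is nonzero, with entry
  1. An exponent \<alpha> therefore determines the multiplicity of each factor as
  \<open>\<alpha> $ v s\<close>, and no two terms of the expanded product collide.\<close>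

lemma lcoeff_prod_geometric:
  fixes \<gamma> :: "'s \<Rightarrow> rat ^ 'v::{finite,linorder}"
  assumes "finite S" "\<And>s s'. s \<in> S \<Longrightarrow> s' \<in> S \<Longrightarrow> \<gamma> s $ v s' = of_bool (s = s')"
  shows "lcoeff (\<Prod>s\<in>S. 1 / (1 - monomial 1 (\<gamma> s))) \<alpha> =
    (if (\<forall>s\<in>S. \<alpha> $ v s \<in> \<int>) \<and> \<alpha> = (\<Sum>s\<in>S. \<alpha> $ v s *s \<gamma> s)
     then \<Prod>s\<in>S. geometric_coeff (\<gamma> s) (\<alpha> $ v s) else 0)"
  using assms
proof (induction S arbitrary: \<alpha> rule: finite_induct)
  case empty
  then show ?case by (simp add: one_laurent_def monomial.rep_eq)
next
  case (insert x S)
  define E where "E = 1 / (1 - monomial 1 (\<gamma> x))"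
  define G where "G = (\<Prod>s\<in>S. 1 / (1 - monomial 1 (\<gamma> s)))"
  define \<beta> where "\<beta> = \<alpha> $ v x *s \<gamma> x"
  have \<gamma>xx: "\<gamma> x $ v x = 1" using insert.prems by simp
  then have \<gamma>x0: "\<gamma> x \<noteq> 0" by auto
  have \<gamma>x: "\<gamma> x $ v s = 0" "\<gamma> s $ v x = 0" if "s \<in> S" for s
    using insert.prems[of x s] insert.prems[of s x] insert.hyps(2) that by auto
  have G: "lcoeff G \<delta> = (if (\<forall>s\<in>S. \<delta> $ v s \<in> \<int>) \<and> \<delta> = (\<Sum>s\<in>S. \<delta> $ v s *s \<gamma> s)
     then \<Prod>s\<in>S. geometric_coeff (\<gamma> s) (\<delta> $ v s) else 0)" for \<delta>
    unfolding G_def by (rule insert.IH) (rule insert.prems; simp)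
  \<comment> \<open>The convolution has at most one nonzero term: exponents of \<open>G\<close>
    vanish at \<open>v x\<close>, which forces the multiplicity of \<open>\<gamma> x\<close> to be
    \<open>\<alpha> $ v x\<close>.\<close>
  have "lcoeff (E * G) \<alpha> = (\<Sum>\<delta>\<in>{\<beta>}. lcoeff E \<delta> * lcoeff G (\<alpha> - \<delta>))"
  proof (rule lcoeff_times, simp, safe)
    fix \<delta> assume nz: "lcoeff E \<delta> \<noteq> 0" "lcoeff G (\<alpha> - \<delta>) \<noteq> 0"
    obtain t where t: "\<delta> = of_int t *s \<gamma> x"
      using nz(1) lcoeff_geometric(2)[OF \<gamma>x0] unfolding E_def by blast
    have "\<alpha> - \<delta> = (\<Sum>s\<in>S. (\<alpha> - \<delta>) $ v s *s \<gamma> s)" using nz(2) G[of "\<alpha> - \<delta>"] by metis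
    then have "(\<alpha> - \<delta>) $ v x = (\<Sum>s\<in>S. (\<alpha> - \<delta>) $ v s *s \<gamma> s) $ v x" by (rule arg_cong)
    then have "\<alpha> $ v x = of_int t" using \<gamma>xx \<gamma>x by (simp add: t)
    then show "\<delta> = \<beta>" by (simp add: \<beta>_def t)
  qed
  then have EG: "lcoeff (E * G) \<alpha> = lcoeff E \<beta> * lcoeff G (\<alpha> - \<beta>)" by simp
  have E: "lcoeff E \<beta> = (if \<alpha> $ v x \<in> \<int> then geometric_coeff (\<gamma> x) (\<alpha> $ v x) else 0)"
  proof (cases "\<alpha> $ v x \<in> \<int>")
    case True
    then obtain t where "\<alpha> $ v x = of_int t" by (rule Ints_cases)
    then show ?thesis using lcoeff_geometric(1)[OF \<gamma>x0] by (simp add: \<beta>_def E_def)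
  next
    case False
    have "\<beta> \<noteq> of_int t *s \<gamma> x" for t
      using False \<gamma>x0 by (auto simp: \<beta>_def vector_mul_rcancel)
    then show ?thesis using False lcoeff_geometric(2)[OF \<gamma>x0] by (simp add: E_def)
  qed
  have v: "(\<alpha> - \<beta>) $ v s = \<alpha> $ v s" if "s \<in> S" for s using \<gamma>x that by (simp add: \<beta>_def)
  have sum: "(\<Sum>s\<in>S. (\<alpha> - \<beta>) $ v s *s \<gamma> s) = (\<Sum>s\<in>S. \<alpha> $ v s *s \<gamma> s)"
    and prod: "(\<Prod>s\<in>S. geometric_coeff (\<gamma> s) ((\<alpha> - \<beta>) $ v s)) =
      (\<Prod>s\<in>S. geometric_coeff (\<gamma> s) (\<alpha> $ v s))"
    and ints: "(\<forall>s\<in>S. (\<alpha> - \<beta>) $ v s \<in> \<int>) \<longleftrightarrow> (\<forall>s\<in>S. \<alpha> $ v s \<in> \<int>)"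
    using v by (auto intro!: sum.cong prod.cong)
  have "\<alpha> - \<beta> = (\<Sum>s\<in>S. \<alpha> $ v s *s \<gamma> s) \<longleftrightarrow> \<alpha> = (\<Sum>s\<in>insert x S. \<alpha> $ v s *s \<gamma> s)"
    using insert.hyps by (simp add: \<beta>_def algebra_simps)
  then have "lcoeff (E * G) \<alpha> =
    (if (\<forall>s\<in>insert x S. \<alpha> $ v s \<in> \<int>) \<and> \<alpha> = (\<Sum>s\<in>insert x S. \<alpha> $ v s *s \<gamma> s)
     then \<Prod>s\<in>insert x S. geometric_coeff (\<gamma> s) (\<alpha> $ v s) else 0)"
    unfolding EG E G sum prod ints using insert.hyps by auto
  then show ?case using insert.hyps by (simp add: E_def G_def)
qed

definition geometric_fraction ::
  "rat ^ 'v::{finite,linorder} \<Rightarrow> ('s \<Rightarrow> rat ^ 'v::{finite,linorder}) \<Rightarrow> 's set \<Rightarrow> 'v laurent" where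
  "geometric_fraction \<gamma>\<^sub>0 \<gamma> S = monomial 1 \<gamma>\<^sub>0 / (\<Prod>s\<in>S. 1 - monomial 1 (\<gamma> s))"

text \<open>Multiplication by the numerator shifts exponents by \<open>\<gamma>\<^sub>0\<close>,
  which vanishes at every \<open>v s\<close> and so leaves the multiplicities unchanged.\<close>

lemma lcoeff_geometric_fraction:
  fixes \<gamma> :: "'s \<Rightarrow> rat ^ 'v::{finite,linorder}"
  assumes "finite S" "\<And>s s'. s \<in> S \<Longrightarrow> s' \<in> S \<Longrightarrow> \<gamma> s $ v s' = of_bool (s = s')"
    and "\<And>s. s \<in> S \<Longrightarrow> \<gamma>\<^sub>0 $ v s = 0"
  shows "lcoeff (geometric_fraction \<gamma>\<^sub>0 \<gamma> S) \<alpha> =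
    (if (\<forall>s\<in>S. \<alpha> $ v s \<in> \<int>) \<and> \<alpha> = \<gamma>\<^sub>0 + (\<Sum>s\<in>S. \<alpha> $ v s *s \<gamma> s)
     then \<Prod>s\<in>S. geometric_coeff (\<gamma> s) (\<alpha> $ v s) else 0)"
proof -
  have "geometric_fraction \<gamma>\<^sub>0 \<gamma> S = monomial 1 \<gamma>\<^sub>0 * (\<Prod>s\<in>S. 1 / (1 - monomial 1 (\<gamma> s)))"
    by (simp add: geometric_fraction_def prod_dividef)
  moreover have "(\<Sum>s\<in>S. (\<alpha> - \<gamma>\<^sub>0) $ v s *s \<gamma> s) = (\<Sum>s\<in>S. \<alpha> $ v s *s \<gamma> s)"
    "(\<Prod>s\<in>S. geometric_coeff (\<gamma> s) ((\<alpha> - \<gamma>\<^sub>0) $ v s)) = (\<Prod>s\<in>S. geometric_coeff (\<gamma> s) (\<alpha> $ v s))"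
    "(\<forall>s\<in>S. (\<alpha> - \<gamma>\<^sub>0) $ v s \<in> \<int>) \<longleftrightarrow> (\<forall>s\<in>S. \<alpha> $ v s \<in> \<int>)"
    using assms(3) by (auto intro!: sum.cong prod.cong)
  moreover have "\<alpha> - \<gamma>\<^sub>0 = X \<longleftrightarrow> \<alpha> = \<gamma>\<^sub>0 + X" for X by (auto simp: algebra_simps)
  ultimately show ?thesis
    by (simp only: lcoeff_monomial_times lcoeff_prod_geometric[OF assms(1,2)] mult_1)
qed

section \<open>Step functions of the columns when one variable is eliminated\<close>

lemma small_smult_pos:
  assumes "c > 0" shows "small (c *s \<gamma>) \<longleftrightarrow> small \<gamma>"
  using assms by (auto simp: small_def zero_less_mult_iff)

lemma small_smult_neg:
  assumes "c < 0" shows "small (c *s \<gamma>) \<longleftrightarrow> small (- \<gamma>)"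
  using assms by (auto simp: small_def zero_less_mult_iff)

text \<open>Column \<open>s\<close> after a pivot in column \<open>j\<close> and the row of the variable \<open>w\<close>.\<close>

definition reduce :: "'v::finite \<Rightarrow> rat ^ 'v::finite \<Rightarrow> rat ^ 'v::finite \<Rightarrow> rat ^ 'v::finite" where
  "reduce w \<delta> \<gamma> = \<gamma> - (\<gamma> $ w / \<delta> $ w) *s \<delta>"

text \<open>Here \<open>v s\<close> stands for the variable y_s marking column \<open>s\<close>, and
  \<open>w\<close> for the variable whose constant term is taken.\<close>

locale geometric_elimination =
  fixes S :: "'s set" and \<gamma> :: "'s \<Rightarrow> rat ^ 'v::{finite,linorder}" and \<gamma>\<^sub>0 :: "rat ^ 'v::{finite,linorder}"
    and v :: "'s \<Rightarrow> 'v" and w :: 'v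
  assumes finite_S: "finite S"
    and diag: "\<And>s s'. s \<in> S \<Longrightarrow> s' \<in> S \<Longrightarrow> \<gamma> s $ v s' = of_bool (s = s')"
    and numer: "\<And>s. s \<in> S \<Longrightarrow> \<gamma>\<^sub>0 $ v s = 0"
begin

definition nonconst :: "'s set" where "nonconst = {s \<in> S. \<gamma> s $ w \<noteq> 0}"
text \<open>The column scaled to entry 1 at \<open>w\<close>. Differences of two poles are then free
  of \<open>w\<close>, which is what a pivot achieves.\<close>

definition pole :: "'s \<Rightarrow> (rat, 'v) vec" where "pole s = (1 / \<gamma> s $ w) *s \<gamma> s"

text \<open>The values of the step function \<open>e\<^sub>s\<close> below and above its jump at \<open>u\<^sub>s = pole s\<close>.\<close>

definition value_below :: "'s \<Rightarrow> rat \<Rightarrow> complex" where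
  "value_below s t = (if \<gamma> s $ w > 0 then of_bool (0 \<le> t) else - of_bool (t < 0))"
definition value_above :: "'s \<Rightarrow> rat \<Rightarrow> complex" where
  "value_above s t = (if \<gamma> s $ w > 0 then - of_bool (t < 0) else of_bool (0 \<le> t))"

definition contrib :: "'s set" where "contrib = {s \<in> nonconst. small (\<gamma> s $ w *s \<gamma> s)}"
definition dual_contrib :: "'s set" where "dual_contrib = {s \<in> nonconst. large (\<gamma> s $ w *s \<gamma> s)}"

lemma nonconst_subset: "nonconst \<subseteq> S" by (auto simp: nonconst_def)

lemma finite_nonconst: "finite nonconst" using nonconst_subset finite_S finite_subset by blast

lemma nonzero: "s \<in> S \<Longrightarrow> \<gamma> s \<noteq> 0"
  using diag[of s s] by auto

text \<open>The indicators of \<open>0 \<le> t\<close> and \<open>t < 0\<close> add up to 1, so the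
  jump is the same for every \<open>t\<close>.\<close>

lemma below_minus_above:
  "s \<in> nonconst \<Longrightarrow> value_below s t - value_above s t = of_rat (sgn (\<gamma> s $ w))"
  by (auto simp: nonconst_def value_below_def value_above_def sgn_if)

text \<open>At coordinate \<open>v s\<close> the pole of \<open>s\<close> is nonzero and all other
  poles vanish.\<close>

lemma inj_pole: "inj_on pole nonconst"
proof (rule inj_onI, rule ccontr)
  fix s s' assume s: "s \<in> nonconst" "s' \<in> nonconst" "pole s = pole s'" "s \<noteq> s'"
  then have "pole s $ v s = pole s' $ v s" by simp
  then show False using s diag[of s s] diag[of s' s] by (auto simp: pole_def nonconst_def)
qed

text \<open>The two vectors differ by the positive factor \<open>(\<gamma> s $ w)^2\<close>.
  Contributing columns are thus those whose jump lies above 0.\<close>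

lemma small_pole: "s \<in> nonconst \<Longrightarrow> small (pole s) \<longleftrightarrow> small (\<gamma> s $ w *s \<gamma> s)"
  by (cases "\<gamma> s $ w > 0")
    (auto simp: pole_def nonconst_def small_smult_pos small_smult_neg)

lemma contrib_iff: "s \<in> contrib \<longleftrightarrow> s \<in> nonconst \<and> lex_less 0 (pole s)"
  using small_pole by (auto simp: contrib_def lex_less_def)

lemma dual_contrib_iff: "s \<in> dual_contrib \<longleftrightarrow> s \<in> nonconst \<and> lex_less (pole s) 0"
proof -
  have "large (\<gamma> s $ w *s \<gamma> s) \<longleftrightarrow> small (- pole s)" if "s \<in> nonconst"
  proof -
    have "pole s \<noteq> 0" "\<gamma> s $ w *s \<gamma> s \<noteq> 0"
      using that nonzero[of s] by (auto simp: pole_def nonconst_def)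
    then show ?thesis
      using small_pole[OF that] small_uminus[of "pole s"] small_cases[of "pole s"]
      by (auto simp: large_def)
  qed
  then show ?thesis by (auto simp: dual_contrib_def lex_less_def)
qed

text \<open>This is e_s(0): since \<open>\<gamma> s\<close> is \<open>\<gamma> s $ w\<close> times
  its pole, a negative entry at \<open>w\<close> exchanges small and large, and the two value
  functions make the same exchange.\<close>

lemma geometric_coeff_nonconst:
  assumes "s \<in> nonconst"
  shows "geometric_coeff (\<gamma> s) t = (if lex_less 0 (pole s) then value_below s t else value_above s t)"
  using assms small_uminus[of "\<gamma> s"] small_cases[of "\<gamma> s"] nonzero[of s]
  by (cases "\<gamma> s $ w > 0")
    (auto simp: nonconst_def pole_def lex_less_def geometric_coeff_def value_below_def value_above_def
      small_smult_pos small_smult_neg)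

text \<open>This is e_s(u_j): the reduced column is \<open>\<gamma> s $ w\<close> times
  \<open>pole s - pole j\<close>, so the evaluation point 0 is replaced by
  \<open>pole j\<close>.\<close>

lemma geometric_coeff_reduce:
  assumes "s \<in> nonconst" "j \<in> nonconst" "s \<noteq> j"
  shows "geometric_coeff (reduce w (\<gamma> j) (\<gamma> s)) t =
    (if lex_less (pole j) (pole s) then value_below s t else value_above s t)"
proof -
  define \<delta> where "\<delta> = pole s - pole j"
  have "\<delta> \<noteq> 0" using inj_pole assms unfolding inj_on_def \<delta>_def by auto
  moreover have "reduce w (\<gamma> j) (\<gamma> s) = \<gamma> s $ w *s \<delta>"
    using assms by (simp add: reduce_def \<delta>_def pole_def nonconst_def vec_eq_iff field_simps)
  ultimately show ?thesis
    using assms small_uminus[of \<delta>] small_cases[of \<delta>]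
    by (cases "\<gamma> s $ w > 0")
      (auto simp: nonconst_def lex_less_def geometric_coeff_def value_below_def value_above_def
        small_smult_pos small_smult_neg simp flip: \<delta>_def)
qed

lemma reduce_const:
  assumes "s \<in> S - nonconst" shows "reduce w (\<gamma> j) (\<gamma> s) = \<gamma> s"
  using assms by (simp add: nonconst_def reduce_def)

text \<open>Columns free of \<open>w\<close> are unchanged by the reduction, so they give a factor
  common to both sides of the identity.\<close>

lemma prod_geometric_coeff_reduce:
  assumes "j \<in> nonconst"
  shows "(\<Prod>s\<in>S - {j}. geometric_coeff (reduce w (\<gamma> j) (\<gamma> s)) (t s)) =
    (\<Prod>s\<in>nonconst - {j}. if lex_less (pole j) (pole s) then value_below s (t s) else value_above s (t s)) *
    (\<Prod>s\<in>S - nonconst. geometric_coeff (\<gamma> s) (t s))"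
proof -
  have "S - {j} = (nonconst - {j}) \<union> (S - nonconst)" using nonconst_subset assms by blast
  then have "(\<Prod>s\<in>S - {j}. geometric_coeff (reduce w (\<gamma> j) (\<gamma> s)) (t s)) =
      (\<Prod>s\<in>nonconst - {j}. geometric_coeff (reduce w (\<gamma> j) (\<gamma> s)) (t s)) *
      (\<Prod>s\<in>S - nonconst. geometric_coeff (reduce w (\<gamma> j) (\<gamma> s)) (t s))"
    using finite_S finite_nonconst by (simp only:) (intro prod.union_disjoint; auto)
  also have "(\<Prod>s\<in>nonconst - {j}. geometric_coeff (reduce w (\<gamma> j) (\<gamma> s)) (t s)) =
      (\<Prod>s\<in>nonconst - {j}. if lex_less (pole j) (pole s) then value_below s (t s) else value_above s (t s))"
    using assms by (intro prod.cong refl geometric_coeff_reduce) auto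
  also have "(\<Prod>s\<in>S - nonconst. geometric_coeff (reduce w (\<gamma> j) (\<gamma> s)) (t s)) =
      (\<Prod>s\<in>S - nonconst. geometric_coeff (\<gamma> s) (t s))"
    by (intro prod.cong refl) (simp add: reduce_const)
  finally show ?thesis .
qed

lemma prod_geometric_coeff:
  "(\<Prod>s\<in>S. geometric_coeff (\<gamma> s) (t s)) =
    (\<Prod>s\<in>nonconst. if lex_less 0 (pole s) then value_below s (t s) else value_above s (t s)) *
    (\<Prod>s\<in>S - nonconst. geometric_coeff (\<gamma> s) (t s))"
proof -
  have "(\<Prod>s\<in>S. geometric_coeff (\<gamma> s) (t s)) =
      (\<Prod>s\<in>S - nonconst. geometric_coeff (\<gamma> s) (t s)) * (\<Prod>s\<in>nonconst. geometric_coeff (\<gamma> s) (t s))"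
    using finite_S nonconst_subset by (rule prod.subset_diff[rotated])
  also have "(\<Prod>s\<in>nonconst. geometric_coeff (\<gamma> s) (t s)) =
      (\<Prod>s\<in>nonconst. if lex_less 0 (pole s) then value_below s (t s) else value_above s (t s))"
    by (intro prod.cong refl geometric_coeff_nonconst)
  finally show ?thesis by (simp only: mult.commute)
qed

text \<open>A nonzero product would need \<open>t s \<le> - 1\<close> where the entry at
  \<open>w\<close> is positive and \<open>t s \<ge> 0\<close> where it is negative. The total
  exponent of \<open>w\<close> being 0 would then make the degree nonnegative.\<close>

lemma prod_above_eq_0:
  assumes deg: "\<gamma>\<^sub>0 $ w - (\<Sum>s | s \<in> S \<and> \<gamma> s $ w > 0. \<gamma> s $ w) < 0"
    and t: "\<And>s. s \<in> S \<Longrightarrow> t s \<in> \<int>" "\<gamma>\<^sub>0 $ w + (\<Sum>s\<in>S. t s * \<gamma> s $ w) = 0"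
  shows "(\<Prod>s\<in>nonconst. value_above s (t s)) = 0"
proof (rule ccontr)
  assume "(\<Prod>s\<in>nonconst. value_above s (t s)) \<noteq> 0"
  then have nz: "value_above s (t s) \<noteq> 0" if "s \<in> nonconst" for s
    using that finite_nonconst by (simp add: prod_zero_iff)
  have "t s * \<gamma> s $ w \<le> (if \<gamma> s $ w > 0 then - (\<gamma> s $ w) else 0)" if s: "s \<in> S" for s
  proof (cases "\<gamma> s $ w" "0 :: rat" rule: linorder_cases)
    case less
    then have "t s \<ge> 0" using nz[of s] s by (auto simp: nonconst_def value_above_def split: if_splits)
    then show ?thesis using less by (simp add: mult_nonneg_nonpos)
  next
    case greater
    then have "t s < 0" using nz[of s] s by (auto simp: nonconst_def value_above_def split: if_splits)
    moreover obtain z where "t s = of_int z" using t(1)[OF s] by (rule Ints_cases)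
    \<comment> \<open>Integrality strengthens \<open>t s < 0\<close> to
      \<open>t s \<le> - 1\<close>; this is how the full sum of positive entries in the degree
      arises.\<close>
    ultimately have "t s \<le> - 1" by (simp add: of_int_less_iff flip: of_int_minus)
    then have "t s * \<gamma> s $ w \<le> - 1 * \<gamma> s $ w" using greater by (intro mult_right_mono) auto
    then show ?thesis using greater by simp
  qed simp
  then have "(\<Sum>s\<in>S. t s * \<gamma> s $ w) \<le> (\<Sum>s\<in>S. if \<gamma> s $ w > 0 then - (\<gamma> s $ w) else 0)"
    by (rule sum_mono)
  also have "\<dots> = - (\<Sum>s | s \<in> S \<and> \<gamma> s $ w > 0. \<gamma> s $ w)"
    using finite_S by (auto simp: sum.inter_filter simp flip: sum_negf intro!: sum.cong)
  finally show False using deg t(2) by simp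
qed

text \<open>Mirror image: now \<open>t s \<ge> 0\<close> for positive and
  \<open>t s \<le> - 1\<close> for negative entries at \<open>w\<close>, which contradicts the
  negative pole order.\<close>

lemma prod_below_eq_0:
  assumes ord: "- (\<gamma>\<^sub>0 $ w) + (\<Sum>s | s \<in> S \<and> \<gamma> s $ w < 0. \<gamma> s $ w) < 0"
    and t: "\<And>s. s \<in> S \<Longrightarrow> t s \<in> \<int>" "\<gamma>\<^sub>0 $ w + (\<Sum>s\<in>S. t s * \<gamma> s $ w) = 0"
  shows "(\<Prod>s\<in>nonconst. value_below s (t s)) = 0"
proof (rule ccontr)
  assume "(\<Prod>s\<in>nonconst. value_below s (t s)) \<noteq> 0"
  then have nz: "value_below s (t s) \<noteq> 0" if "s \<in> nonconst" for s
    using that finite_nonconst by (simp add: prod_zero_iff)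
  have "(if \<gamma> s $ w < 0 then - (\<gamma> s $ w) else 0) \<le> t s * \<gamma> s $ w" if s: "s \<in> S" for s
  proof (cases "\<gamma> s $ w" "0 :: rat" rule: linorder_cases)
    case greater
    then have "t s \<ge> 0" using nz[of s] s by (auto simp: nonconst_def value_below_def split: if_splits)
    then show ?thesis using greater by simp
  next
    case less
    then have "t s < 0" using nz[of s] s by (auto simp: nonconst_def value_below_def split: if_splits)
    moreover obtain z where "t s = of_int z" using t(1)[OF s] by (rule Ints_cases)
    ultimately have "t s \<le> - 1" by (simp add: of_int_less_iff flip: of_int_minus)
    then have "- 1 * \<gamma> s $ w \<le> t s * \<gamma> s $ w" using less by (intro mult_right_mono_neg) auto
    then show ?thesis using less by simp
  qed simp
  then have "(\<Sum>s\<in>S. if \<gamma> s $ w < 0 then - (\<gamma> s $ w) else 0) \<le> (\<Sum>s\<in>S. t s * \<gamma> s $ w)"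
    by (rule sum_mono)
  moreover have "(\<Sum>s\<in>S. if \<gamma> s $ w < 0 then - (\<gamma> s $ w) else 0) =
      - (\<Sum>s | s \<in> S \<and> \<gamma> s $ w < 0. \<gamma> s $ w)"
    using finite_S by (auto simp: sum.inter_filter simp flip: sum_negf intro!: sum.cong)
  ultimately show False using ord t(2) by simp
qed

text \<open>The product of the upper values is zero, so subtracting it turns the left side into a
  difference of the step product between 0 and +infinity, which telescopes over the poles above
  0.\<close>

lemma prod_geometric_coeff_eq_contrib:
  assumes "\<gamma>\<^sub>0 $ w - (\<Sum>s | s \<in> S \<and> \<gamma> s $ w > 0. \<gamma> s $ w) < 0"
    and "\<And>s. s \<in> S \<Longrightarrow> t s \<in> \<int>" "\<gamma>\<^sub>0 $ w + (\<Sum>s\<in>S. t s * \<gamma> s $ w) = 0"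
  shows "(\<Prod>s\<in>S. geometric_coeff (\<gamma> s) (t s)) = (\<Sum>j\<in>contrib. of_rat (sgn (\<gamma> j $ w)) *
    (\<Prod>s\<in>S - {j}. geometric_coeff (reduce w (\<gamma> j) (\<gamma> s)) (t s)))"
proof -
  let ?K = "\<Prod>s\<in>S - nonconst. geometric_coeff (\<gamma> s) (t s)"
  have "(\<Prod>s\<in>S. geometric_coeff (\<gamma> s) (t s)) =
      ((\<Prod>s\<in>nonconst. if lex_less 0 (pole s) then value_below s (t s) else value_above s (t s)) -
        (\<Prod>s\<in>nonconst. value_above s (t s))) * ?K"
    using prod_geometric_coeff prod_above_eq_0[OF assms] by simp
  also have "\<dots> = (\<Sum>j | j \<in> nonconst \<and> lex_less 0 (pole j). (value_below j (t j) - value_above j (t j)) *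
      (\<Prod>s\<in>nonconst - {j}. if lex_less (pole j) (pole s) then value_below s (t s) else value_above s (t s))) * ?K"
    by (subst lex.prod_step_telescope[OF finite_nonconst inj_pole]) (rule refl)
  also have "\<dots> = (\<Sum>j\<in>contrib. of_rat (sgn (\<gamma> j $ w)) *
      (\<Prod>s\<in>S - {j}. geometric_coeff (reduce w (\<gamma> j) (\<gamma> s)) (t s)))"
    unfolding sum_distrib_right
  proof (rule sum.cong)
    show "{j. j \<in> nonconst \<and> lex_less 0 (pole j)} = contrib" using contrib_iff by blast
  qed (simp add: contrib_iff below_minus_above prod_geometric_coeff_reduce mult.assoc)
  finally show ?thesis .
qed

lemma prod_geometric_coeff_eq_dual_contrib:
  assumes "- (\<gamma>\<^sub>0 $ w) + (\<Sum>s | s \<in> S \<and> \<gamma> s $ w < 0. \<gamma> s $ w) < 0"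
    and "\<And>s. s \<in> S \<Longrightarrow> t s \<in> \<int>" "\<gamma>\<^sub>0 $ w + (\<Sum>s\<in>S. t s * \<gamma> s $ w) = 0"
  shows "(\<Prod>s\<in>S. geometric_coeff (\<gamma> s) (t s)) = - (\<Sum>j\<in>dual_contrib. of_rat (sgn (\<gamma> j $ w)) *
    (\<Prod>s\<in>S - {j}. geometric_coeff (reduce w (\<gamma> j) (\<gamma> s)) (t s)))"
proof -
  let ?K = "\<Prod>s\<in>S - nonconst. geometric_coeff (\<gamma> s) (t s)"
  have pole0: "pole s \<noteq> 0" if "s \<in> nonconst" for s
    using that nonzero[of s] by (auto simp: pole_def nonconst_def)
  have vanish: "(\<Prod>s\<in>nonconst. value_below s (t s)) = 0"
    by (rule prod_below_eq_0[OF assms])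
  \<comment> \<open>No pole is 0, so the value at 0 may be expressed with the reversed
    comparison.\<close>
  have flip: "(\<Prod>s\<in>nonconst. if lex_less 0 (pole s) then value_below s (t s) else value_above s (t s)) =
      (\<Prod>s\<in>nonconst. if lex_less (pole s) 0 then value_above s (t s) else value_below s (t s))"
    using pole0 by (intro prod.cong refl) (auto dest: lex.less_asym simp: lex.neq_iff)
  have "(\<Prod>s\<in>S. geometric_coeff (\<gamma> s) (t s)) =
      ((\<Prod>s\<in>nonconst. if lex_less (pole s) 0 then value_above s (t s) else value_below s (t s)) -
        (\<Prod>s\<in>nonconst. value_below s (t s))) * ?K"
    unfolding prod_geometric_coeff flip vanish diff_zero by (rule refl)
  \<comment> \<open>Telescoping in the reversed order runs over the poles below 0. It exchanges the
    two values of each step, whence the minus sign.\<close>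
  also have "\<dots> = (\<Sum>j | j \<in> nonconst \<and> lex_less (pole j) 0. (value_above j (t j) - value_below j (t j)) *
      (\<Prod>s\<in>nonconst - {j}. if lex_less (pole s) (pole j) then value_above s (t s) else value_below s (t s))) * ?K"
    by (subst linorder.prod_step_telescope[OF lex.dual_linorder finite_nonconst inj_pole]) (rule refl)
  also have "\<dots> = (\<Sum>j\<in>dual_contrib. - (of_rat (sgn (\<gamma> j $ w)) *
      (\<Prod>s\<in>S - {j}. geometric_coeff (reduce w (\<gamma> j) (\<gamma> s)) (t s))))"
    unfolding sum_distrib_right
  proof (rule sum.cong)
    show "{j. j \<in> nonconst \<and> lex_less (pole j) 0} = dual_contrib" using dual_contrib_iff by blast
    fix j assume "j \<in> dual_contrib"
    then have j: "j \<in> nonconst" by (simp add: dual_contrib_iff)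
    \<comment> \<open>Poles are pairwise distinct, so e_s(u_j) can be written with either
      comparison.\<close>
    have "(\<Prod>s\<in>nonconst - {j}. if lex_less (pole s) (pole j) then value_above s (t s) else value_below s (t s)) =
        (\<Prod>s\<in>nonconst - {j}. if lex_less (pole j) (pole s) then value_below s (t s) else value_above s (t s))"
    proof (rule prod.cong[OF refl])
      fix s assume "s \<in> nonconst - {j}"
      then have "pole s \<noteq> pole j" using inj_pole j by (auto simp: inj_on_def)
      then show "(if lex_less (pole s) (pole j) then value_above s (t s) else value_below s (t s)) =
          (if lex_less (pole j) (pole s) then value_below s (t s) else value_above s (t s))"
        using lex.less_asym lex.neq_iff by auto
    qed
    moreover have "value_above j (t j) - value_below j (t j) = - of_rat (sgn (\<gamma> j $ w))"
      using below_minus_above[OF j, of "t j"] by (simp add: algebra_simps)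
    ultimately show "(value_above j (t j) - value_below j (t j)) *
        (\<Prod>s\<in>nonconst - {j}. if lex_less (pole s) (pole j) then value_above s (t s) else value_below s (t s)) * ?K =
      - (of_rat (sgn (\<gamma> j $ w)) *
        (\<Prod>s\<in>S - {j}. geometric_coeff (reduce w (\<gamma> j) (\<gamma> s)) (t s)))"
      by (simp add: prod_geometric_coeff_reduce[OF j])
  qed
  finally show ?thesis by (simp only: sum_negf)
qed

section \<open>Supports of both sides\<close>

text \<open>The exponents free of \<open>w\<close> that integral multiplicities can produce. The
  same set turns out to govern every summand on the right.\<close>

definition supported :: "(rat, 'v) vec \<Rightarrow> bool" where
  "supported \<alpha> \<longleftrightarrow> \<alpha> $ w = 0 \<and> (\<forall>s\<in>S. \<alpha> $ v s \<in> \<int>) \<and> \<alpha> = \<gamma>\<^sub>0 + (\<Sum>s\<in>S. \<alpha> $ v s *s \<gamma> s)"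

lemma supported_weight:
  assumes "supported \<alpha>" shows "\<gamma>\<^sub>0 $ w + (\<Sum>s\<in>S. \<alpha> $ v s * \<gamma> s $ w) = 0"
proof -
  have "\<alpha> $ w = (\<gamma>\<^sub>0 + (\<Sum>s\<in>S. \<alpha> $ v s *s \<gamma> s)) $ w"
    using assms unfolding supported_def by (metis (no_types))
  then show ?thesis using assms by (simp add: supported_def)
qed

lemma lcoeff_CT:
  "lcoeff (CT w (geometric_fraction \<gamma>\<^sub>0 \<gamma> S)) \<alpha> =
    (if supported \<alpha> then \<Prod>s\<in>S. geometric_coeff (\<gamma> s) (\<alpha> $ v s) else 0)"
  using lcoeff_geometric_fraction[OF finite_S diag numer] by (auto simp: CT.rep_eq supported_def)

text \<open>Each reduction subtracts a multiple of \<open>\<gamma> j\<close>; collected, they give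
  column \<open>j\<close> the multiplicity \<tau>, the one value that makes the total entry at
  \<open>w\<close> zero.\<close>

lemma reduce_sum:
  fixes x :: "'s \<Rightarrow> rat"
  assumes j: "j \<in> nonconst"
  defines "\<tau> \<equiv> - (\<gamma>\<^sub>0 $ w + (\<Sum>s\<in>S - {j}. x s * \<gamma> s $ w)) / \<gamma> j $ w"
  shows "reduce w (\<gamma> j) \<gamma>\<^sub>0 + (\<Sum>s\<in>S - {j}. x s *s reduce w (\<gamma> j) (\<gamma> s)) =
    \<gamma>\<^sub>0 + (\<Sum>s\<in>S - {j}. x s *s \<gamma> s) + \<tau> *s \<gamma> j"
proof (subst vec_eq_iff, intro allI)
  fix u
  have nz: "\<gamma> j $ w \<noteq> 0" using j by (simp add: nonconst_def)
  have "(\<Sum>s\<in>S - {j}. x s * (\<gamma> s $ u - \<gamma> s $ w / \<gamma> j $ w * \<gamma> j $ u)) =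
      (\<Sum>s\<in>S - {j}. x s * \<gamma> s $ u) - (\<Sum>s\<in>S - {j}. x s * \<gamma> s $ w) * (\<gamma> j $ u / \<gamma> j $ w)"
    unfolding sum_distrib_right by (simp add: right_diff_distrib sum_subtractf ac_simps)
  then show "(reduce w (\<gamma> j) \<gamma>\<^sub>0 + (\<Sum>s\<in>S - {j}. x s *s reduce w (\<gamma> j) (\<gamma> s))) $ u =
      (\<gamma>\<^sub>0 + (\<Sum>s\<in>S - {j}. x s *s \<gamma> s) + \<tau> *s \<gamma> j) $ u"
    by (simp add: reduce_def \<tau>_def) (use nz in \<open>simp add: field_simps\<close>)
qed

text \<open>The condition \<open>\<alpha> $ w = 0\<close> can be solved for the multiplicity of
  column \<open>j\<close>. Conversely, reading coordinate \<open>v j\<close>, where only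
  \<open>\<gamma> j\<close> is nonzero, recovers that multiplicity as
  \<open>\<alpha> $ v j\<close>.\<close>

lemma supported_iff_reduce:
  assumes j: "j \<in> nonconst"
  shows "supported \<alpha> \<longleftrightarrow> (\<forall>s\<in>S. \<alpha> $ v s \<in> \<int>) \<and>
    \<alpha> = reduce w (\<gamma> j) \<gamma>\<^sub>0 + (\<Sum>s\<in>S - {j}. \<alpha> $ v s *s reduce w (\<gamma> j) (\<gamma> s))"
proof -
  define B where "B = \<gamma>\<^sub>0 $ w + (\<Sum>s\<in>S - {j}. \<alpha> $ v s * \<gamma> s $ w)"
  define X where "X = \<gamma>\<^sub>0 + (\<Sum>s\<in>S - {j}. \<alpha> $ v s *s \<gamma> s)"
  have jS: "j \<in> S" and nz: "\<gamma> j $ w \<noteq> 0" using j by (auto simp: nonconst_def)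
  have full: "\<gamma>\<^sub>0 + (\<Sum>s\<in>S. \<alpha> $ v s *s \<gamma> s) = X + \<alpha> $ v j *s \<gamma> j"
    using sum.remove[OF finite_S jS, of "\<lambda>s. \<alpha> $ v s *s \<gamma> s"] by (simp add: X_def ac_simps)
  have red: "reduce w (\<gamma> j) \<gamma>\<^sub>0 + (\<Sum>s\<in>S - {j}. \<alpha> $ v s *s reduce w (\<gamma> j) (\<gamma> s)) =
      X + (- B / \<gamma> j $ w) *s \<gamma> j"
    unfolding reduce_sum[OF j] B_def X_def by (rule refl)
  have Xw: "X $ w = B" by (simp add: X_def B_def)
  have "X $ v j = 0" using jS numer diag by (simp add: X_def)
  then have vj: "(X + \<tau> *s \<gamma> j) $ v j = \<tau>" for \<tau> using diag[OF jS jS] by simp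
  have "\<alpha> $ w = 0 \<and> \<alpha> = X + \<alpha> $ v j *s \<gamma> j \<longleftrightarrow> \<alpha> = X + (- B / \<gamma> j $ w) *s \<gamma> j"
  proof
    assume a: "\<alpha> $ w = 0 \<and> \<alpha> = X + \<alpha> $ v j *s \<gamma> j"
    then have "(X + \<alpha> $ v j *s \<gamma> j) $ w = 0" by metis
    then have "B + \<alpha> $ v j * \<gamma> j $ w = 0" by (simp add: Xw)
    then have "- B / \<gamma> j $ w = \<alpha> $ v j" using nz by (simp add: field_simps)
    then show "\<alpha> = X + (- B / \<gamma> j $ w) *s \<gamma> j" using a by simp
  next
    assume a: "\<alpha> = X + (- B / \<gamma> j $ w) *s \<gamma> j"
    have "\<alpha> $ v j = - B / \<gamma> j $ w" by (subst a) (rule vj)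
    moreover have "\<alpha> $ w = 0" by (subst a) (simp add: Xw nz)
    ultimately show "\<alpha> $ w = 0 \<and> \<alpha> = X + \<alpha> $ v j *s \<gamma> j" using a by simp
  qed
  then show ?thesis unfolding supported_def full red by blast
qed

text \<open>After the elimination \<open>\<alpha> $ v j\<close> is only known to be rational; the
  integral part in \<open>v j\<close> restores exactly the missing integrality condition.\<close>

lemma lcoeff_integral_part:
  assumes j: "j \<in> nonconst"
  shows "lcoeff (integral_part (v j)
      (geometric_fraction (reduce w (\<gamma> j) \<gamma>\<^sub>0) (\<lambda>s. reduce w (\<gamma> j) (\<gamma> s)) (S - {j}))) \<alpha> =
    (if supported \<alpha> then \<Prod>s\<in>S - {j}. geometric_coeff (reduce w (\<gamma> j) (\<gamma> s)) (\<alpha> $ v s) else 0)"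
proof -
  have jS: "j \<in> S" using j by (simp add: nonconst_def)
  have "reduce w (\<gamma> j) (\<gamma> s) $ v s' = of_bool (s = s')" if "s \<in> S - {j}" "s' \<in> S - {j}" for s s'
    using that diag jS by (auto simp: reduce_def)
  moreover have "reduce w (\<gamma> j) \<gamma>\<^sub>0 $ v s = 0" if "s \<in> S - {j}" for s
    using that diag numer jS by (auto simp: reduce_def)
  ultimately have "lcoeff (geometric_fraction (reduce w (\<gamma> j) \<gamma>\<^sub>0) (\<lambda>s. reduce w (\<gamma> j) (\<gamma> s)) (S - {j})) \<alpha> =
    (if (\<forall>s\<in>S - {j}. \<alpha> $ v s \<in> \<int>) \<and>
        \<alpha> = reduce w (\<gamma> j) \<gamma>\<^sub>0 + (\<Sum>s\<in>S - {j}. \<alpha> $ v s *s reduce w (\<gamma> j) (\<gamma> s))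
     then \<Prod>s\<in>S - {j}. geometric_coeff (reduce w (\<gamma> j) (\<gamma> s)) (\<alpha> $ v s) else 0)"
    using finite_S by (intro lcoeff_geometric_fraction) auto
  then show ?thesis
    unfolding integral_part.rep_eq supported_iff_reduce[OF j] using jS by auto
qed

end

section \<open>Constant term identities for geometric fractions\<close>

lemma of_rat_sgn_laurent: "(of_rat (sgn q) :: 'v::{finite,linorder} laurent) = monomial (of_rat (sgn q)) 0"
proof -
  have "(- 1 :: 'v laurent) = monomial (- 1) 0"
    by (rule laurent_eqI) (simp add: uminus_laurent.rep_eq one_laurent_def monomial.rep_eq)
  moreover have "(0 :: 'v laurent) = monomial 0 0"
    by (rule laurent_eqI) (simp add: zero_laurent.rep_eq monomial.rep_eq)
  ultimately show ?thesis by (simp add: sgn_if one_laurent_def)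
qed

lemma lcoeff_sum: "lcoeff (sum F X) \<alpha> = (\<Sum>x\<in>X. lcoeff (F x) \<alpha>)"
  by (induction X rule: infinite_finite_induct) (simp_all add: zero_laurent.rep_eq plus_laurent.rep_eq)

context geometric_elimination
begin

text \<open>Formulated for any set of columns involving \<open>w\<close>, to serve
  \<open>contrib\<close> and \<open>dual_contrib\<close> alike.\<close>

lemma lcoeff_residue_sum:
  assumes "X \<subseteq> nonconst"
  shows "lcoeff (\<Sum>j\<in>X. of_rat (sgn (\<gamma> j $ w)) * integral_part (v j)
      (geometric_fraction (reduce w (\<gamma> j) \<gamma>\<^sub>0) (\<lambda>s. reduce w (\<gamma> j) (\<gamma> s)) (S - {j}))) \<alpha> =
    (if supported \<alpha> then \<Sum>j\<in>X. of_rat (sgn (\<gamma> j $ w)) *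
      (\<Prod>s\<in>S - {j}. geometric_coeff (reduce w (\<gamma> j) (\<gamma> s)) (\<alpha> $ v s)) else 0)"
  unfolding lcoeff_sum of_rat_sgn_laurent lcoeff_monomial_times diff_zero
  using assms by (simp add: lcoeff_integral_part subset_iff)

text \<open>Coefficients at unsupported \<alpha> vanish on both sides; at supported \<alpha> the
  numerical identity applies with \<open>t s = \<alpha> $ v s\<close>.\<close>

theorem CT_eq_contrib:
  assumes "\<gamma>\<^sub>0 $ w - (\<Sum>s | s \<in> S \<and> \<gamma> s $ w > 0. \<gamma> s $ w) < 0"
  shows "CT w (geometric_fraction \<gamma>\<^sub>0 \<gamma> S) =
    (\<Sum>j\<in>contrib. of_rat (sgn (\<gamma> j $ w)) * integral_part (v j)
      (geometric_fraction (reduce w (\<gamma> j) \<gamma>\<^sub>0) (\<lambda>s. reduce w (\<gamma> j) (\<gamma> s)) (S - {j})))"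
proof (rule laurent_eqI)
  fix \<alpha>
  have "contrib \<subseteq> nonconst" by (auto simp: contrib_def)
  moreover have "\<alpha> $ v s \<in> \<int>" if "supported \<alpha>" "s \<in> S" for s
    using that by (simp add: supported_def)
  ultimately show "lcoeff (CT w (geometric_fraction \<gamma>\<^sub>0 \<gamma> S)) \<alpha> = lcoeff (\<Sum>j\<in>contrib.
      of_rat (sgn (\<gamma> j $ w)) * integral_part (v j)
      (geometric_fraction (reduce w (\<gamma> j) \<gamma>\<^sub>0) (\<lambda>s. reduce w (\<gamma> j) (\<gamma> s)) (S - {j}))) \<alpha>"
    by (simp add: lcoeff_CT lcoeff_residue_sum supported_weight
        prod_geometric_coeff_eq_contrib[OF assms, of "\<lambda>s. \<alpha> $ v s"])
qed

theorem CT_eq_dual_contrib: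
  assumes "- (\<gamma>\<^sub>0 $ w) + (\<Sum>s | s \<in> S \<and> \<gamma> s $ w < 0. \<gamma> s $ w) < 0"
  shows "CT w (geometric_fraction \<gamma>\<^sub>0 \<gamma> S) =
    - (\<Sum>j\<in>dual_contrib. of_rat (sgn (\<gamma> j $ w)) * integral_part (v j)
      (geometric_fraction (reduce w (\<gamma> j) \<gamma>\<^sub>0) (\<lambda>s. reduce w (\<gamma> j) (\<gamma> s)) (S - {j})))"
proof (rule laurent_eqI)
  fix \<alpha>
  have "dual_contrib \<subseteq> nonconst" by (auto simp: dual_contrib_def)
  moreover have "\<alpha> $ v s \<in> \<int>" if "supported \<alpha>" "s \<in> S" for s
    using that by (simp add: supported_def)
  ultimately show "lcoeff (CT w (geometric_fraction \<gamma>\<^sub>0 \<gamma> S)) \<alpha> = lcoeff (- (\<Sum>j\<in>dual_contrib.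
      of_rat (sgn (\<gamma> j $ w)) * integral_part (v j)
      (geometric_fraction (reduce w (\<gamma> j) \<gamma>\<^sub>0) (\<lambda>s. reduce w (\<gamma> j) (\<gamma> s)) (S - {j})))) \<alpha>"
    by (simp add: lcoeff_CT lcoeff_residue_sum supported_weight uminus_laurent.rep_eq
        prod_geometric_coeff_eq_dual_contrib[OF assms, of "\<lambda>s. \<alpha> $ v s"])
qed

end

section \<open>Matrix forms as geometric fractions\<close>

text \<open>A pivot in column \<open>j\<close> alters row y_l only by multiples of its entry in
  column \<open>j\<close>, which is 0 for \<open>l\<close> different from \<open>j\<close>. So the
  row stays a unit row until column \<open>l\<close> itself is used.\<close>

lemma pivots_Yvar_row:
  assumes "pivots (initial_matrix A b) k I J P" "l \<notin> J"
  shows "P $ Yvar l $ s = of_bool (s = Some l)"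
  using assms
proof (induction arbitrary: s)
  case start
  then show ?case by (simp add: initial_matrix_def)
next
  case (step k I J P i j)
  then show ?case by (auto simp: pivot_def)
qed

text \<open>In the pivot row the reduction yields 0, in agreement with that row being ignored
  afterwards.\<close>

lemma exponent_pivot:
  assumes "P $ Lvar i $ Some j \<noteq> 0" "i \<notin> I" "s \<noteq> Some j"
  shows "exponent (insert i I) (pivot P i j) s =
    reduce (Lvar i) (exponent I P (Some j)) (exponent I P s)"
  using assms by (auto simp: vec_eq_iff exponent_def pivot_def reduce_def)

lemma bracket_eq_geometric_fraction:
  "bracket I J P = geometric_fraction (exponent I P None) (\<lambda>s. exponent I P (Some s)) (UNIV - J)"
  by (simp add: bracket_def geometric_fraction_def)

lemma bracket_pivot:
  assumes "P $ Lvar i $ Some j \<noteq> 0" "i \<notin> I"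
  shows "bracket (insert i I) (insert j J) (pivot P i j) =
    geometric_fraction (reduce (Lvar i) (exponent I P (Some j)) (exponent I P None))
      (\<lambda>s. reduce (Lvar i) (exponent I P (Some j)) (exponent I P (Some s))) (UNIV - J - {j})"
proof -
  have "UNIV - insert j J = UNIV - J - {j}" by blast
  then show ?thesis
    unfolding bracket_eq_geometric_fraction geometric_fraction_def
    using assms by (simp add: exponent_pivot)
qed

theorem lemma17:
  fixes A :: "int ^ 'n::{finite,linorder} ^ 'r::{finite,linorder}" and b :: "int ^ 'r::{finite,linorder}"
    and k :: nat and I :: "'r set" and J :: "'n set" and P :: "('n, 'r) form_matrix" and i :: 'r
  assumes "pivots (initial_matrix A b) k I J P" and "i \<notin> I"
  shows "(c_plus I J P i < \<infinity> \<longrightarrow>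
      CT (Lvar i) (bracket I J P) =
        (\<Sum>j | j \<notin> J \<and> contributing I P i j.
          of_rat (sgn (P $ Lvar i $ Some j)) *
          integral_part (Yvar j) (bracket (insert i I) (insert j J) (pivot P i j)))) \<and>
    (c_minus I J P i < \<infinity> \<longrightarrow>
      CT (Lvar i) (bracket I J P) =
        - (\<Sum>j | j \<notin> J \<and> dually_contributing I P i j.
          of_rat (sgn (P $ Lvar i $ Some j)) *
          integral_part (Yvar j) (bracket (insert i I) (insert j J) (pivot P i j))))"
proof -
  define \<gamma> where "\<gamma> = (\<lambda>s. exponent I P (Some s))"
  define \<gamma>\<^sub>0 where "\<gamma>\<^sub>0 = exponent I P None"
  \<comment> \<open>The surviving unit rows of the y_s with \<open>s \<notin> J\<close> supply the
    diagonal pattern and the zeros of the numerator.\<close>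
  interpret geometric_elimination "UNIV - J" \<gamma> \<gamma>\<^sub>0 Yvar "Lvar i"
    using pivots_Yvar_row[OF assms(1)]
    by unfold_locales (auto simp: \<gamma>_def \<gamma>\<^sub>0_def exponent_def)
  have entry: "\<gamma> j $ Lvar i = P $ Lvar i $ Some j" for j
    using assms(2) by (auto simp: \<gamma>_def exponent_def)
  \<comment> \<open>For columns in \<open>nonconst\<close> the pivot entry is nonzero, so the
    pivoted bracket is the reduced fraction.\<close>
  have summand: "of_rat (sgn (P $ Lvar i $ Some j)) *
      integral_part (Yvar j) (bracket (insert i I) (insert j J) (pivot P i j)) =
    of_rat (sgn (\<gamma> j $ Lvar i)) * integral_part (Yvar j)
      (geometric_fraction (reduce (Lvar i) (\<gamma> j) \<gamma>\<^sub>0) (\<lambda>s. reduce (Lvar i) (\<gamma> j) (\<gamma> s)) (UNIV - J - {j}))"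
    if "j \<in> nonconst" for j
  proof -
    have "P $ Lvar i $ Some j \<noteq> 0" using that entry by (simp add: nonconst_def)
    from bracket_pivot[OF this assms(2)] show ?thesis by (simp flip: entry add: \<gamma>_def \<gamma>\<^sub>0_def)
  qed
  have C: "{j. j \<notin> J \<and> contributing I P i j} = contrib"
    unfolding contrib_def nonconst_def contributing_def Let_def by (auto simp: \<gamma>_def)
  have D: "{j. j \<notin> J \<and> dually_contributing I P i j} = dual_contrib"
    unfolding dual_contrib_def nonconst_def dually_contributing_def Let_def by (auto simp: \<gamma>_def)
  have br: "bracket I J P = geometric_fraction \<gamma>\<^sub>0 \<gamma> (UNIV - J)"
    by (simp add: bracket_eq_geometric_fraction \<gamma>_def \<gamma>\<^sub>0_def)
  show ?thesis
  proof (intro conjI impI)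
    assume "c_plus I J P i < \<infinity>"
    then have "\<gamma>\<^sub>0 $ Lvar i - (\<Sum>s | s \<in> UNIV - J \<and> \<gamma> s $ Lvar i > 0. \<gamma> s $ Lvar i) < 0"
      by (simp add: c_plus_def lambda_degree_def \<gamma>_def \<gamma>\<^sub>0_def split: if_splits)
    from CT_eq_contrib[OF this] show "CT (Lvar i) (bracket I J P) =
        (\<Sum>j | j \<notin> J \<and> contributing I P i j. of_rat (sgn (P $ Lvar i $ Some j)) *
          integral_part (Yvar j) (bracket (insert i I) (insert j J) (pivot P i j)))"
      unfolding br C using sum.cong[OF refl summand, of contrib] contrib_iff by simp
  next
    assume "c_minus I J P i < \<infinity>"
    then have "- (\<gamma>\<^sub>0 $ Lvar i) + (\<Sum>s | s \<in> UNIV - J \<and> \<gamma> s $ Lvar i < 0. \<gamma> s $ Lvar i) < 0"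
      by (simp add: c_minus_def lambda_pole_order_def \<gamma>_def \<gamma>\<^sub>0_def split: if_splits)
    from CT_eq_dual_contrib[OF this] show "CT (Lvar i) (bracket I J P) =
        - (\<Sum>j | j \<notin> J \<and> dually_contributing I P i j. of_rat (sgn (P $ Lvar i $ Some j)) *
          integral_part (Yvar j) (bracket (insert i I) (insert j J) (pivot P i j)))"
      unfolding br D using sum.cong[OF refl summand, of dual_contrib] dual_contrib_iff by simp
  qed
qed

end
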